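(* Consider one of the three models ASEP, GZRP, BLP, with coupled generator $L$ on pairs $(\underline\omega,\underline\zeta)$ (see context). Let $\underline m=(m_i)_{i\in\mathbb Z}$ be nonnegative integers with $\sum_{i}m_i<\infty$, let $\underline\sigma=(\sigma_i)_{i\in\mathbb Z}$ be a parameter vector, and let $\underline\nu^{\underline\sigma,\underline m}$ be the product measure on pairs with $m_i$ second class particles at site $i$, built from one-site marginals $\hat\mu^{\sigma_i,m_i}$ (see context). The identity $$\begin{aligned}\frac{\mathrm d}{\mathrm dt}\,\underline\nu^{\underline\sigma,\underline m}S(t)\Bigr|_{t=0}=\sum_{i\in\mathbb Z}\Bigl\{&P(m_i,m_{i+1},\sigma_i,\sigma_{i+1})\bigl[\underline\nu^{\underline\sigma^{i,i+1},\underline m^{i,i+1}}-\underline\nu^{\underline\sigma,\underline m}\bigr]\\&+Q(m_i,m_{i+1},\sigma_i,\sigma_{i+1})\bigl[\underline\nu^{\underline\sigma^{i+1,i},\underline m^{i+1,i}}-\underline\nu^{\underline\sigma,\underline m}\bigr]\Bigr\}\end{aligned}$$ holds, in the sense of test functions, in each of the following cases. (i) ASEP, parametrized by densities $\varrho_i\in(0,1)$ in place of $\sigma_i$, if $m_i\in\{0,1\}$ for all $i$, for all $i\in\mathbb Z$ $$\frac{\varrho_{i+1}(1-\varrho_i)}{\varrho_i(1-\varrho_{i+1})}=\begin{cases}1,&m_{i+1}=0,\\ p/q,&m_{i+1}=1,\end{cases}$$ and $$\hat\mu^{\varrho,m}(0)=1-\hat\mu^{\varrho,m}(1)=\begin{cases}1-\varrho,&m=0,\\1,&m=1.\end{cases}$$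 In this case $\varrho^{i,i+1}_j=\varrho_j$ for $j\ne i$ and $\varrho^{i,i+1}_i=\varrho_{i-1}$; $\varrho^{i+1,i}_j=\varrho_j$ for $j\neq i$ and $\varrho^{i+1,i}_i=\varrho_{i+1}$; and $$P(m_i,m_{i+1},\varrho_i,\varrho_{i+1})=m_i(1-m_{i+1})\bigl[(1-\varrho_{i+1})p+\varrho_{i+1}q\bigr],$$ $$Q(m_i,m_{i+1},\varrho_i,\varrho_{i+1})=(1-m_i)m_{i+1}\bigl[(1-\varrho_i)q+\varrho_ip\bigr].$$ (ii) GZRP or BLP with $\sigma_i\in\mathbb R$, if $\sigma_{i-1}-\sigma_i=\beta m_i$ for all $i\in\mathbb Z$, and $\hat\mu^{\sigma,m}(y)=\mu^\sigma(y)$ for all $y\in\mathbb Z$, regardless of $m$. In this case $\sigma^{i,i+1}_j=\sigma_j$ for $j\ne i$ and $\sigma^{i,i+1}_i=\sigma_i+\beta$; $\sigma^{i+1,i}_j=\sigma_j$ for $j\ne i$ and $\sigma^{i+1,i}_i=\sigma_i-\beta$; for both models $$P(m_i,m_{i+1},\sigma_i,\sigma_{i+1})=e^{\sigma_i+\beta m_i}-e^{\sigma_i},$$ while $Q(m_i,m_{i+1},\sigma_i,\sigma_{i+1})=0$ for the GZRP, and $Q(m_i,m_{i+1},\sigma_i,\sigma_{i+1})=e^{-\sigma_{i+1}}-e^{-\sigma_{i+1}-\beta m_{i+1}}$ for the BLP.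
   Context: Models. Configurations are $\underline\omega\in I^{\mathbb Z}$. For $i\neq j$, $\underline\omega^{i,j}$ is the configuration obtained from $\underline\omega$ by replacing $\omega_i$ by $\omega_i-1$ and $\omega_j$ by $\omega_j+1$; the same notation $\underline m^{i,j}$ is used for $\underline m$ (but $\underline\sigma^{i,j}$, $\underline\varrho^{i,j}$ are the modified parameter vectors specified in the claim). The process jumps $\underline\omega\to\underline\omega^{i,i+1}$ with rate $p(\omega_i,\omega_{i+1})$ and $\underline\omega\to\underline\omega^{i+1,i}$ with rate $q(\omega_i,\omega_{i+1})$, for every $i\in\mathbb Z$. - ASEP: $I=\{0,1\}$, $p(y,z)=p\cdot\mathbf 1\{y=1,z=0\}$, $q(y,z)=q\cdot\mathbf 1\{y=0,z=1\}$, with reals $p>q\ge 0$, $p+q=1$ (and $q>0$ wherever $p/q$ occurs). - GZRP (generalized totally asymmetric exponential zero range process): $I=\mathbb Z$, $p(y,z)=f(y)$, $q\equiv0$, with $f(y)=e^{\beta(y-1/2)}$, $\beta>0$. - BLP (totally asymmetric exponential bricklayers process): $I=\mathbb Z$, $p(y,z)=f(y)+f(-z)$, $q\equiv 0$, with the same $f$. For GZRP and BLP and $\sigma\in\mathbb R$, the stationary one-site marginal is $\mu^\sigma(z)=\frac{1}{Z(\sigma)}e^{\sigma z-\beta z^2/2}$, $z\in\mathbb Z$, where $Z(\sigma)=\sum_{z\in\mathbb Z}e^{\sigma z-\beta z^2/2}$. Coupled dynamics (basic coupling). For pairs with $\omega_i\le\zeta_i$ for all $i$, and $\varphi$ a function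 depending on finitely many coordinates of the pair (a finite cylinder function), $$\begin{aligned}(L\varphi)(\underline\omega,\underline\zeta)=\sum_{i\in\mathbb Z}\Bigl\{&p(\omega_i,\zeta_{i+1})[\varphi(\underline\omega^{i,i+1},\underline\zeta^{i,i+1})-\varphi(\underline\omega,\underline\zeta)]\\&+[p(\omega_i,\omega_{i+1})-p(\omega_i,\zeta_{i+1})][\varphi(\underline\omega^{i,i+1},\underline\zeta)-\varphi(\underline\omega,\underline\zeta)]\\&+[p(\zeta_i,\zeta_{i+1})-p(\omega_i,\zeta_{i+1})][\varphi(\underline\omega,\underline\zeta^{i,i+1})-\varphi(\underline\omega,\underline\zeta)]\\&+q(\zeta_i,\omega_{i+1})[\varphi(\underline\omega^{i+1,i},\underline\zeta^{i+1,i})-\varphi(\underline\omega,\underline\zeta)]\\&+[q(\zeta_i,\zeta_{i+1})-q(\zeta_i,\omega_{i+1})][\varphi(\underline\omega,\underline\zeta^{i+1,i})-\varphi(\underline\omega,\underline\zeta)]\\&+[q(\omega_i,\omega_{i+1})-q(\zeta_i,\omega_{i+1})][\varphi(\underline\omega^{i+1,i},\underline\zeta)-\varphi(\underline\omega,\underline\zeta)]\Bigr\}\end{aligned}$$ (only finitely many terms are nonzero; terms with zero rate are taken to be zero). The number of second class particles at site $i$ is $\zeta_i-\omega_i$. Shock measures. $\underline\nu^{\underline\sigma,\underline m}$ is the product over sites $i\in\mathbb Z$ of the one-site measures on pairs under which $\zeta_i=\omega_i+m_i$ and $\omega_i\sim\hat\mu^{\sigma_i,m_i}$, where $\hat\mu^{\sigma,m}$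 is a probability measure on $I$ (for ASEP giving probability zero to values $y>1-m$). Meaning of the identity. $\underline\nu S(t)$ is the law of the coupled pair at time $t$ started from $\underline\nu$. It is a standing assumption that the dynamics exists, with the usual properties of semigroup and generator. The identity "in the sense of test functions" means that for every bounded finite cylinder function $\varphi$ of the pair, $\frac{\mathrm d}{\mathrm dt}\int\varphi\,\mathrm d(\underline\nu^{\underline\sigma,\underline m}S(t))\big|_{t=0}=\int L\varphi\,\mathrm d\underline\nu^{\underline\sigma,\underline m}$ equals the right-hand side integrated against $\varphi$. Terms on the right-hand side whose coefficient $P$ or $Q$ is zero are taken to be zero (even if the vector $\underline m^{i,i+1}$ or $\underline m^{i+1,i}$ is not admissible). *)

theory Defs
  imports "HOL-Probability.Probability"
begin

text \<open>A coupled configuration is a map \<open>x :: int \<Rightarrow> int \<times> int\<close> with \<open>x i = (\<omega>\<^sub>i, \<zeta>\<^sub>i)\<close>.  A model with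
  one-site state space \<open>I\<close> lives on the subset \<open>coupled_configs I\<close>.\<close>

type_synonym coupled_config = "int \<Rightarrow> int \<times> int"

definition pair_config :: "(int \<Rightarrow> int) \<Rightarrow> (int \<Rightarrow> int) \<Rightarrow> coupled_config" where
  "pair_config \<omega> \<zeta> = (\<lambda>i. (\<omega> i, \<zeta> i))"

definition lower :: "coupled_config \<Rightarrow> int \<Rightarrow> int" where
  "lower x = (\<lambda>i. fst (x i))"

definition upper :: "coupled_config \<Rightarrow> int \<Rightarrow> int" where
  "upper x = (\<lambda>i. snd (x i))"

definition config_space :: "coupled_config measure" where
  "config_space = Pi\<^sub>M UNIV (\<lambda>_. count_space UNIV)"

definition coupled_configs :: "int set \<Rightarrow> coupled_config set" where
  "coupled_configs I = {x. \<forall>i. lower x i \<in> I \<and> upper x i \<in> I \<and> lower x i \<le> upper x i}"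

text \<open>\<open>move i j x\<close> is \<open>x\<^sup>i\<^sup>,\<^sup>j\<close>, used for \<open>i \<noteq> j\<close> only.  On \<open>nat\<close>-valued vectors the subtraction truncates
  at \<open>x i = 0\<close>; below this only occurs multiplied by a zero coefficient.\<close>

definition move :: "int \<Rightarrow> int \<Rightarrow> (int \<Rightarrow> 'a::{one,plus,minus}) \<Rightarrow> int \<Rightarrow> 'a" where
  "move i j x = x(i := x i - 1, j := x j + 1)"

definition bounded_cylinder :: "(coupled_config \<Rightarrow> real) \<Rightarrow> bool" where
  "bounded_cylinder \<phi> \<longleftrightarrow>
     (\<exists>J. finite J \<and> (\<forall>x y. (\<forall>i\<in>J. x i = y i) \<longrightarrow> \<phi> x = \<phi> y)) \<and> bounded (range \<phi>)"


section \<open>Jump rates and the coupled generator\<close>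

definition asep_p :: "real \<Rightarrow> int \<Rightarrow> int \<Rightarrow> real" where
  "asep_p p y z = (if y = 1 \<and> z = 0 then p else 0)"

definition asep_q :: "real \<Rightarrow> int \<Rightarrow> int \<Rightarrow> real" where
  "asep_q q y z = (if y = 0 \<and> z = 1 then q else 0)"

definition exp_rate :: "real \<Rightarrow> int \<Rightarrow> real" where
  "exp_rate \<beta> y = exp (\<beta> * (real_of_int y - 1 / 2))"

definition gzrp_p :: "real \<Rightarrow> int \<Rightarrow> int \<Rightarrow> real" where
  "gzrp_p \<beta> y z = exp_rate \<beta> y"

definition blp_p :: "real \<Rightarrow> int \<Rightarrow> int \<Rightarrow> real" where
  "blp_p \<beta> y z = exp_rate \<beta> y + exp_rate \<beta> (- z)"

definition zero_rate :: "int \<Rightarrow> int \<Rightarrow> real" where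
  "zero_rate y z = 0"

definition coupled_generator_term ::
  "(int \<Rightarrow> int \<Rightarrow> real) \<Rightarrow> (int \<Rightarrow> int \<Rightarrow> real) \<Rightarrow> (coupled_config \<Rightarrow> real) \<Rightarrow> coupled_config \<Rightarrow> int \<Rightarrow> real"
where
  "coupled_generator_term p q \<phi> x i =
    (let \<omega> = lower x; \<zeta> = upper x; \<psi> = (\<lambda>\<omega>' \<zeta>'. \<phi> (pair_config \<omega>' \<zeta>') - \<phi> x) in
       p (\<omega> i) (\<zeta> (i+1)) * \<psi> (move i (i+1) \<omega>) (move i (i+1) \<zeta>)
     + (p (\<omega> i) (\<omega> (i+1)) - p (\<omega> i) (\<zeta> (i+1))) * \<psi> (move i (i+1) \<omega>) \<zeta>
     + (p (\<zeta> i) (\<zeta> (i+1)) - p (\<omega> i) (\<zeta> (i+1))) * \<psi> \<omega> (move i (i+1) \<zeta>)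
     + q (\<zeta> i) (\<omega> (i+1)) * \<psi> (move (i+1) i \<omega>) (move (i+1) i \<zeta>)
     + (q (\<zeta> i) (\<zeta> (i+1)) - q (\<zeta> i) (\<omega> (i+1))) * \<psi> \<omega> (move (i+1) i \<zeta>)
     + (q (\<omega> i) (\<omega> (i+1)) - q (\<zeta> i) (\<omega> (i+1))) * \<psi> (move (i+1) i \<omega>) \<zeta>)"

text \<open>The sum has only finitely many nonzero terms for a cylinder function, see the lemma below.\<close>

definition coupled_generator ::
  "(int \<Rightarrow> int \<Rightarrow> real) \<Rightarrow> (int \<Rightarrow> int \<Rightarrow> real) \<Rightarrow> (coupled_config \<Rightarrow> real) \<Rightarrow> coupled_config \<Rightarrow> real"
where
  "coupled_generator p q \<phi> x = (\<Sum>\<^sub>\<infinity>i\<in>UNIV. coupled_generator_term p q \<phi> x i)"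

lemma finite_coupled_generator_terms:
  assumes "bounded_cylinder \<phi>"
  shows "finite {i. coupled_generator_term p q \<phi> x i \<noteq> 0}"
proof -
  from assms obtain J where J: "finite J" "\<And>x y. (\<forall>i\<in>J. x i = y i) \<Longrightarrow> \<phi> x = \<phi> y"
    unfolding bounded_cylinder_def by blast
  have "coupled_generator_term p q \<phi> x i = 0" if i: "i \<notin> J" "i + 1 \<notin> J" for i
  proof -
    have eq: "\<phi> (pair_config \<omega>' \<zeta>') = \<phi> x"
      if "\<omega>' \<in> {lower x, move i (i+1) (lower x), move (i+1) i (lower x)}"
         "\<zeta>' \<in> {upper x, move i (i+1) (upper x), move (i+1) i (upper x)}" for \<omega>' \<zeta>'
      using that i by (intro J(2)) (auto simp: pair_config_def move_def lower_def upper_def)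
    show ?thesis
      unfolding coupled_generator_term_def Let_def by (simp add: eq)
  qed
  then have "{i. coupled_generator_term p q \<phi> x i \<noteq> 0} \<subseteq> J \<union> (\<lambda>j. j - 1) ` J"
    by (force simp: image_iff)
  then show ?thesis
    using J(1) by (meson finite_UnI finite_imageI finite_subset)
qed


section \<open>The dynamics\<close>

definition markov_semigroup :: "'a measure \<Rightarrow> (real \<Rightarrow> 'a \<Rightarrow> 'a measure) \<Rightarrow> bool" where
  "markov_semigroup M S \<longleftrightarrow>
     (\<forall>t\<ge>0. S t \<in> M \<rightarrow>\<^sub>M prob_algebra M) \<and>
     (\<forall>x\<in>space M. S 0 x = return M x) \<and>
     (\<forall>s\<ge>0. \<forall>t\<ge>0. \<forall>x\<in>space M. S (s + t) x = S s x \<bind> S t)"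

text \<open>The law at time \<open>t\<close> started from \<open>\<nu>\<close> is \<open>\<nu> \<bind> S t\<close>.  The rates of the exponential models are
  unbounded, so there is no generator on a space of functions; the standing assumption that the
  dynamics exists and is generated by \<open>L\<close> is made for the given initial law \<open>\<nu>\<close>, and only for those
  test functions for which \<open>\<integral> L \<phi> d\<nu>\<close> makes sense.\<close>

definition coupled_dynamics ::
  "int set \<Rightarrow> (int \<Rightarrow> int \<Rightarrow> real) \<Rightarrow> (int \<Rightarrow> int \<Rightarrow> real) \<Rightarrow> coupled_config measure
     \<Rightarrow> (real \<Rightarrow> coupled_config \<Rightarrow> coupled_config measure) \<Rightarrow> bool"
where
  "coupled_dynamics I p q \<nu> S \<longleftrightarrow>
     markov_semigroup config_space S \<and>
     (\<forall>t\<ge>0. \<forall>x\<in>coupled_configs I. AE y in S t x. y \<in> coupled_configs I) \<and>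
     (\<forall>\<phi>. bounded_cylinder \<phi> \<longrightarrow> integrable \<nu> (coupled_generator p q \<phi>) \<longrightarrow>
        ((\<lambda>t. \<integral>x. \<phi> x \<partial>(\<nu> \<bind> S t)) has_real_derivative (\<integral>x. coupled_generator p q \<phi> x \<partial>\<nu>))
          (at 0 within {0..}))"


section \<open>Shock measures and the evolution identity\<close>

definition stationary_weight :: "real \<Rightarrow> real \<Rightarrow> int \<Rightarrow> real" where
  "stationary_weight \<beta> \<sigma> z =
     exp (\<sigma> * real_of_int z - \<beta> * (real_of_int z)\<^sup>2 / 2) /
     (\<Sum>\<^sub>\<infinity>y\<in>(UNIV :: int set). exp (\<sigma> * real_of_int y - \<beta> * (real_of_int y)\<^sup>2 / 2))"

definition shock_measure ::
  "(real \<Rightarrow> nat \<Rightarrow> int pmf) \<Rightarrow> (int \<Rightarrow> real) \<Rightarrow> (int \<Rightarrow> nat) \<Rightarrow> coupled_config measure"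
where
  "shock_measure \<mu> \<sigma> m =
     Pi\<^sub>M UNIV (\<lambda>i. measure_pmf (map_pmf (\<lambda>y. (y, y + int (m i))) (\<mu> (\<sigma> i) (m i))))"

text \<open>\<open>\<sigma>R i\<close> and \<open>\<sigma>L i\<close> are the parameter vectors \<open>\<sigma>\<^sup>i\<^sup>,\<^sup>i\<^sup>+\<^sup>1\<close> and \<open>\<sigma>\<^sup>i\<^sup>+\<^sup>1\<^sup>,\<^sup>i\<close>.\<close>

definition shock_term ::
  "(real \<Rightarrow> nat \<Rightarrow> int pmf) \<Rightarrow> (int \<Rightarrow> real) \<Rightarrow> (int \<Rightarrow> nat)
     \<Rightarrow> (nat \<Rightarrow> nat \<Rightarrow> real \<Rightarrow> real \<Rightarrow> real) \<Rightarrow> (nat \<Rightarrow> nat \<Rightarrow> real \<Rightarrow> real \<Rightarrow> real)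
     \<Rightarrow> (int \<Rightarrow> int \<Rightarrow> real) \<Rightarrow> (int \<Rightarrow> int \<Rightarrow> real) \<Rightarrow> (coupled_config \<Rightarrow> real) \<Rightarrow> int \<Rightarrow> real"
where
  "shock_term \<mu> \<sigma> m P Q \<sigma>R \<sigma>L \<phi> i =
     P (m i) (m (i+1)) (\<sigma> i) (\<sigma> (i+1)) *
       ((\<integral>x. \<phi> x \<partial>shock_measure \<mu> (\<sigma>R i) (move i (i+1) m)) - (\<integral>x. \<phi> x \<partial>shock_measure \<mu> \<sigma> m))
   + Q (m i) (m (i+1)) (\<sigma> i) (\<sigma> (i+1)) *
       ((\<integral>x. \<phi> x \<partial>shock_measure \<mu> (\<sigma>L i) (move (i+1) i m)) - (\<integral>x. \<phi> x \<partial>shock_measure \<mu> \<sigma> m))"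

text \<open>The derivative at \<open>0\<close> is one-sided.\<close>

definition shock_evolution ::
  "(int \<Rightarrow> int \<Rightarrow> real) \<Rightarrow> (int \<Rightarrow> int \<Rightarrow> real) \<Rightarrow> (real \<Rightarrow> coupled_config \<Rightarrow> coupled_config measure)
     \<Rightarrow> (real \<Rightarrow> nat \<Rightarrow> int pmf) \<Rightarrow> (int \<Rightarrow> real) \<Rightarrow> (int \<Rightarrow> nat)
     \<Rightarrow> (nat \<Rightarrow> nat \<Rightarrow> real \<Rightarrow> real \<Rightarrow> real) \<Rightarrow> (nat \<Rightarrow> nat \<Rightarrow> real \<Rightarrow> real \<Rightarrow> real)
     \<Rightarrow> (int \<Rightarrow> int \<Rightarrow> real) \<Rightarrow> (int \<Rightarrow> int \<Rightarrow> real) \<Rightarrow> bool"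
where
  "shock_evolution p q S \<mu> \<sigma> m P Q \<sigma>R \<sigma>L \<longleftrightarrow>
     (\<forall>\<phi>. bounded_cylinder \<phi> \<longrightarrow>
        integrable (shock_measure \<mu> \<sigma> m) (coupled_generator p q \<phi>) \<and>
        (shock_term \<mu> \<sigma> m P Q \<sigma>R \<sigma>L \<phi> has_sum
           (\<integral>x. coupled_generator p q \<phi> x \<partial>shock_measure \<mu> \<sigma> m)) UNIV \<and>
        ((\<lambda>t. \<integral>x. \<phi> x \<partial>(shock_measure \<mu> \<sigma> m \<bind> S t)) has_real_derivative
           (\<Sum>\<^sub>\<infinity>i\<in>UNIV. shock_term \<mu> \<sigma> m P Q \<sigma>R \<sigma>L \<phi> i)) (at 0 within {0..}))"

end

theory Submission
  imports Defs
begin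

text \<open>
  The dynamics hypothesis already equates the time derivative with \<open>\<integral> L \<phi> d\<nu>\<close>, so what has to be shown
  is that \<open>L \<phi>\<close> is integrable and that \<open>\<integral> L \<phi> d\<nu>\<close> is the right-hand side.  The identity does not hold
  bond by bond, but it does up to a discrete gradient: there is a function \<open>T\<close> of the site with
  \<open>\<integral> L\<^sub>i \<phi> d\<nu> = s\<^sub>i + T(i+1) - T(i)\<close>, where \<open>L\<^sub>i\<close> and \<open>s\<^sub>i\<close> are the parts of \<open>L\<close> and of the right-hand side belonging to the bond
  \<open>(i, i+1)\<close>, and \<open>T(i) = 0\<close> as soon as \<open>\<phi>\<close> does not look at site \<open>i\<close>.  Only finitely many bonds
  contribute for a cylinder function, and the gradient sums to zero (\<open>shock_evolution_telescope\<close>).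
  For \<open>m = 0\<close> this is the usual proof that a product measure is stationary; with second class
  particles, the relation between the parameters of neighbouring sites is what makes the coefficients
  of \<open>T\<close> match from one bond to the next.

  The exponential models.  Write \<open>f\<close> for the exponential rate.  Weighting \<open>\<mu>\<^sup>\<sigma>\<close> by \<open>f(y)\<close> gives
  \<open>e\<^sup>\<sigma>\<close> times the stationary law at parameter \<open>\<sigma> + \<beta>\<close>, and that law is the translate of \<open>\<mu>\<^sup>\<sigma>\<close> by one;
  likewise \<open>f(-y)\<close> with \<open>\<sigma> - \<beta>\<close> (\<open>exp_rate_stationary_weight\<close>, \<open>stationary_weight_shift\<close>).  So each summand of the
  generator, a rate at one site times a difference created by translating two sites, integrates to a
  difference of integrals of \<open>\<phi>\<close> against product measures with other parameters
  (\<open>has_integral_weighted_jump\<close>).  Both models have the rate \<open>f(y) + \<kappa> f(-z)\<close>, with \<open>\<kappa> = 0\<close> or \<open>\<kappa> = 1\<close>.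
  With \<open>A\<close> the integral of \<open>\<phi>\<close> under \<open>\<nu>\<close>, and \<open>A\<^sub>i\<close>, \<open>B\<^sub>i\<close> the same after changing \<open>\<sigma>\<^sub>i\<close> to
  \<open>\<sigma>\<^sub>i + \<beta>\<close> and \<open>\<sigma>\<^sub>i - \<beta>\<close>, the gradient is that of
  \<open>T(i) = exp (\<sigma>\<^sub>i + \<beta> m\<^sub>i) (A\<^sub>i - A) - \<kappa> exp (- \<sigma>\<^sub>i) (B\<^sub>i - A)\<close>, because
  \<open>\<sigma>\<^sub>i\<^sub>+\<^sub>1 + \<beta> m\<^sub>i\<^sub>+\<^sub>1 = \<sigma>\<^sub>i\<close>.

  The exclusion process.  A site without second class particle has only the states \<open>(0,0)\<close> and \<open>(1,1)\<close>, a
  site with one only the state \<open>(0,1)\<close>.  Expanding all integrals over the states of the two sites of a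
  bond (\<open>integral_finite_support_two_sites\<close>) leaves an algebraic identity in each of the four cases for
  \<open>(m\<^sub>i, m\<^sub>i\<^sub>+\<^sub>1)\<close>.  Here \<open>T(i)\<close> is \<open>(p - q) \<rho>\<^sub>i (1 - \<rho>\<^sub>i)\<close> times the effect on \<open>\<integral> \<phi> d\<nu>\<close> of setting site
  \<open>i\<close> to \<open>(1,1)\<close> instead of \<open>(0,0)\<close> if \<open>m\<^sub>i = 0\<close>, and zero if \<open>m\<^sub>i = 1\<close>.
\<close>

section \<open>Bounded cylinder functions\<close>

lemma space_config_space [simp]: "space config_space = UNIV"
  by (simp add: config_space_def space_PiM)

lemma measurable_coordinate [measurable]: "(\<lambda>x. x i) \<in> config_space \<rightarrow>\<^sub>M count_space UNIV"
  unfolding config_space_def by measurable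

lemma measurable_update_site [measurable]:
  "(\<lambda>x. x(i := t (x i))) \<in> config_space \<rightarrow>\<^sub>M config_space"
  unfolding config_space_def
  by (rule measurable_PiM_single') (auto simp: space_PiM fun_upd_def)

text \<open>A function of finitely many coordinates factors through a finite product of countable discrete
  spaces, where everything is measurable.\<close>

lemma bounded_cylinder_measurable [measurable_dest]:
  assumes "bounded_cylinder \<phi>"
  shows "\<phi> \<in> borel_measurable config_space"
proof -
  from assms obtain J where J: "finite J" "\<And>x y. (\<forall>i\<in>J. x i = y i) \<Longrightarrow> \<phi> x = \<phi> y"
    unfolding bounded_cylinder_def by blast
  have "(\<lambda>x. restrict x J) \<in> config_space \<rightarrow>\<^sub>M Pi\<^sub>M J (\<lambda>_. count_space (UNIV :: (int \<times> int) set))"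
    unfolding config_space_def by (rule measurable_restrict_subset) auto
  moreover have "Pi\<^sub>M J (\<lambda>_. count_space (UNIV :: (int \<times> int) set)) = count_space (PiE J (\<lambda>_. UNIV))"
    using J(1) by (intro count_space_PiM_finite) auto
  ultimately have "(\<lambda>x. \<phi> (restrict x J)) \<in> borel_measurable config_space"
    by (metis measurable_compose measurable_count_space_eq1 Pi_UNIV UNIV_I borel_measurable_count_space)
  also have "(\<lambda>x. \<phi> (restrict x J)) = \<phi>"
    by (intro ext J(2)) auto
  finally show ?thesis .
qed

lemma bounded_cylinder_bound:
  assumes "bounded_cylinder \<phi>"
  obtains C where "\<And>x. \<bar>\<phi> x\<bar> \<le> C"
  using assms unfolding bounded_cylinder_def bounded_iff by (auto simp: image_iff)

lemma bounded_cylinder_combine: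
  assumes "bounded_cylinder \<phi>" "bounded_cylinder \<psi>" "bounded (range (\<lambda>x. h (\<phi> x) (\<psi> x)))"
  shows "bounded_cylinder (\<lambda>x. h (\<phi> x) (\<psi> x))"
proof -
  from assms(1,2) obtain J K where J: "finite J" "\<And>x y. (\<forall>i\<in>J. x i = y i) \<Longrightarrow> \<phi> x = \<phi> y"
    and K: "finite K" "\<And>x y. (\<forall>i\<in>K. x i = y i) \<Longrightarrow> \<psi> x = \<psi> y"
    unfolding bounded_cylinder_def by metis
  have "h (\<phi> x) (\<psi> x) = h (\<phi> y) (\<psi> y)" if "\<forall>i\<in>J \<union> K. x i = y i" for x y
    using that J(2)[of x y] K(2)[of x y] by simp
  with J(1) K(1) assms(3) show ?thesis
    unfolding bounded_cylinder_def by (meson finite_UnI)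
qed

lemma bounded_cylinder_diff:
  assumes "bounded_cylinder \<phi>" "bounded_cylinder \<psi>"
  shows "bounded_cylinder (\<lambda>x. \<phi> x - \<psi> x)"
  using bounded_minus_comp[of \<phi> UNIV \<psi>] assms
  by (intro bounded_cylinder_combine[where h = "(-)", OF assms]) (simp add: bounded_cylinder_def)

lemma bounded_cylinder_add:
  assumes "bounded_cylinder \<phi>" "bounded_cylinder \<psi>"
  shows "bounded_cylinder (\<lambda>x. \<phi> x + \<psi> x)"
  using bounded_plus_comp[of \<phi> UNIV \<psi>] assms
  by (intro bounded_cylinder_combine[where h = "(+)", OF assms]) (simp add: bounded_cylinder_def)

lemma bounded_cylinder_mult:
  assumes "bounded_cylinder \<phi>" "bounded_cylinder \<psi>"
  shows "bounded_cylinder (\<lambda>x. \<phi> x * \<psi> x)"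
proof (rule bounded_cylinder_combine[where h = "(*)", OF assms])
  obtain C where C: "\<And>x. \<bar>\<phi> x\<bar> \<le> C" using bounded_cylinder_bound[OF assms(1)] by blast
  obtain D where D: "\<And>x. \<bar>\<psi> x\<bar> \<le> D" using bounded_cylinder_bound[OF assms(2)] by blast
  have "\<bar>\<phi> x * \<psi> x\<bar> \<le> C * D" for x
    unfolding abs_mult using C[of x] D[of x] by (intro mult_mono) auto
  then show "bounded (range (\<lambda>x. \<phi> x * \<psi> x))"
    by (auto simp: bounded_iff)
qed

lemma bounded_cylinder_two_sites:
  assumes "bounded (range (\<lambda>(a, b). h a b))"
  shows "bounded_cylinder (\<lambda>x. h (x i) (x j))"
  unfolding bounded_cylinder_def
proof (intro conjI exI[of _ "{i, j}"])
  show "bounded (range (\<lambda>x. h (x i) (x j)))"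
    by (rule bounded_subset[OF assms]) auto
qed auto

lemma bounded_cylinder_update_site:
  assumes "bounded_cylinder \<phi>"
  shows "bounded_cylinder (\<lambda>x. \<phi> (x(i := t (x i))))"
proof -
  from assms obtain J where J: "finite J" "\<And>x y. (\<forall>i\<in>J. x i = y i) \<Longrightarrow> \<phi> x = \<phi> y"
    and b: "bounded (range \<phi>)"
    unfolding bounded_cylinder_def by blast
  have "\<phi> (x(i := t (x i))) = \<phi> (y(i := t (y i)))" if "\<forall>i\<in>J. x i = y i" for x y
    using that by (intro J(2)) auto
  moreover have "bounded (range (\<lambda>x. \<phi> (x(i := t (x i)))))"
    by (rule bounded_subset[OF b]) auto
  ultimately show ?thesis
    unfolding bounded_cylinder_def using J(1) by blast
qed

lemma bounded_cylinder_update_two_sites: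
  assumes "bounded_cylinder \<phi>" "i \<noteq> j"
  shows "bounded_cylinder (\<lambda>x. \<phi> (x(i := t (x i), j := s (x j))))"
proof -
  have "bounded_cylinder (\<lambda>x. \<phi> ((x(i := t (x i)))(j := s ((x(i := t (x i))) j))))"
    by (rule bounded_cylinder_update_site[OF bounded_cylinder_update_site[OF assms(1)]])
  then show ?thesis
    using assms(2) by simp
qed

section \<open>Product measures under weighting and updating one site\<close>

text \<open>Shock measures, and every measure that arises from them by tilting or moving the state of a site,
  are of this form; the calculations below only change the function \<open>N\<close>.\<close>

definition site_product :: "(int \<Rightarrow> (int \<times> int) pmf) \<Rightarrow> coupled_config measure" where
  "site_product N = Pi\<^sub>M UNIV (\<lambda>i. measure_pmf (N i))"

lemma sets_site_product [measurable_cong]: "sets (site_product N) = sets config_space"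
  unfolding site_product_def config_space_def by (intro sets_PiM_cong) auto

lemma space_site_product [simp]: "space (site_product N) = UNIV"
  by (simp add: site_product_def space_PiM)

lemma prob_space_site_product: "prob_space (site_product N)"
  unfolding site_product_def by (intro prob_space_PiM) (rule prob_space_measure_pmf)

lemma bounded_cylinder_integrable:
  assumes "bounded_cylinder \<phi>"
  shows "integrable (site_product N) \<phi>"
proof -
  interpret prob_space "site_product N" by (rule prob_space_site_product)
  obtain C where "\<And>x. \<bar>\<phi> x\<bar> \<le> C" using bounded_cylinder_bound[OF assms] by blast
  then show ?thesis
    using bounded_cylinder_measurable[OF assms]
    by (intro integrable_const_bound[of _ C]) auto
qed

definition pair_law :: "int pmf \<Rightarrow> nat \<Rightarrow> (int \<times> int) pmf" where
  "pair_law M k = map_pmf (\<lambda>y. (y, y + int k)) M"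

lemma shock_measure_eq:
  "shock_measure \<mu> \<sigma> m = site_product (\<lambda>i. pair_law (\<mu> (\<sigma> i) (m i)) (m i))"
  by (simp add: shock_measure_def site_product_def pair_law_def)

text \<open>Independence of site \<open>i\<close> from the rest, as Tonelli's theorem.\<close>

lemma nn_integral_site_product_split:
  assumes [measurable]: "f \<in> borel_measurable config_space"
  shows "(\<integral>\<^sup>+x. f x \<partial>site_product N) =
    (\<integral>\<^sup>+a. \<integral>\<^sup>+x. f (x(i := a)) \<partial>Pi\<^sub>M (UNIV - {i}) (\<lambda>j. measure_pmf (N j)) \<partial>measure_pmf (N i))"
proof -
  let ?R = "Pi\<^sub>M (UNIV - {i}) (\<lambda>j. measure_pmf (N j))"
  interpret R: prob_space ?R by (intro prob_space_PiM) (rule prob_space_measure_pmf)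
  have split: "site_product N =
      distr (measure_pmf (N i) \<Otimes>\<^sub>M ?R) (site_product N) (\<lambda>(a, x). x(i := a))"
    using distr_pair_PiM_eq_PiM[of "UNIV - {i}" "\<lambda>j. measure_pmf (N j)" i]
    by (simp add: site_product_def prob_space_measure_pmf insert_absorb)
  have [measurable]: "(\<lambda>(a, x). x(i := a)) \<in> measure_pmf (N i) \<Otimes>\<^sub>M ?R \<rightarrow>\<^sub>M site_product N"
    unfolding site_product_def split_beta
    by (rule measurable_fun_upd[where J = "UNIV - {i}"]) auto
  have [measurable]: "f \<in> borel_measurable (site_product N)"
    by measurable
  have "(\<integral>\<^sup>+x. f x \<partial>site_product N) = (\<integral>\<^sup>+z. f (case z of (a, x) \<Rightarrow> x(i := a)) \<partial>(measure_pmf (N i) \<Otimes>\<^sub>M ?R))"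
    by (subst split, subst nn_integral_distr) auto
  also have "\<dots> = (\<integral>\<^sup>+a. \<integral>\<^sup>+x. f (x(i := a)) \<partial>?R \<partial>measure_pmf (N i))"
    by (subst R.nn_integral_fst[symmetric]) auto
  finally show ?thesis .
qed

lemma PiM_off_site:
  "Pi\<^sub>M (UNIV - {i}) (\<lambda>j. measure_pmf ((N(i := M)) j)) = Pi\<^sub>M (UNIV - {i}) (\<lambda>j. measure_pmf (N j))"
  by (intro PiM_cong) auto

lemma measurable_insert_site:
  "(\<lambda>x. x(i := a)) \<in> Pi\<^sub>M (UNIV - {i}) (\<lambda>j. measure_pmf (N j)) \<rightarrow>\<^sub>M config_space"
  unfolding config_space_def
  by (rule measurable_fun_upd[where J = "UNIV - {i}"]) (auto intro!: measurable_ident_sets sets_PiM_cong)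

lemma distr_site_product_update:
  "distr (site_product N) config_space (\<lambda>x. x(i := t (x i))) = site_product (N(i := map_pmf t (N i)))"
proof (rule measure_eqI)
  fix A assume "A \<in> sets (distr (site_product N) config_space (\<lambda>x. x(i := t (x i))))"
  then have [measurable]: "A \<in> sets config_space" by simp
  have "emeasure (distr (site_product N) config_space (\<lambda>x. x(i := t (x i)))) A =
      (\<integral>\<^sup>+x. indicator A (x(i := t (x i))) \<partial>site_product N)"
    by (simp add: nn_integral_distr flip: nn_integral_indicator)
  also have "\<dots> = (\<integral>\<^sup>+x. indicator A x \<partial>site_product (N(i := map_pmf t (N i))))"
    by (subst (1 2) nn_integral_site_product_split[of _ _ i])
       (auto simp: PiM_off_site fun_upd_same simp del: fun_upd_apply)
  finally show "emeasure (distr (site_product N) config_space (\<lambda>x. x(i := t (x i)))) A =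
      emeasure (site_product (N(i := map_pmf t (N i)))) A"
    by (simp add: sets_site_product)
qed (simp add: sets_site_product)

text \<open>Tilting: a weight depending on the state of one site only changes the law of this site.\<close>

lemma density_site_product:
  assumes "0 < c" "\<And>a. 0 \<le> w a" "\<And>a. w a * pmf (N i) a = c * pmf N' a"
  shows "density (site_product N) (\<lambda>x. ennreal (w (x i) / c)) = site_product (N(i := N'))"
proof (rule measure_eqI)
  have weight: "ennreal (pmf (N i) a) * ennreal (w a / c) = ennreal (pmf N' a)" for a
    using assms(1) assms(2,3)[of a] by (simp add: field_simps flip: ennreal_mult)
  fix A assume "A \<in> sets (density (site_product N) (\<lambda>x. ennreal (w (x i) / c)))"
  then have [measurable]: "A \<in> sets config_space" by (simp add: sets_site_product)
  have "emeasure (density (site_product N) (\<lambda>x. ennreal (w (x i) / c))) A =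
      (\<integral>\<^sup>+x. ennreal (w (x i) / c) * indicator A x \<partial>site_product N)"
    by (subst emeasure_density) (auto simp: sets_site_product)
  also have "\<dots> = (\<integral>\<^sup>+a. ennreal (w a / c) * \<integral>\<^sup>+x. indicator A (x(i := a))
      \<partial>Pi\<^sub>M (UNIV - {i}) (\<lambda>j. measure_pmf (N j)) \<partial>measure_pmf (N i))"
    by (subst nn_integral_site_product_split[of _ _ i])
       (auto intro!: nn_integral_cong nn_integral_cmult measurable_compose[OF measurable_insert_site])
  also have "\<dots> = (\<integral>\<^sup>+x. indicator A x \<partial>site_product (N(i := N')))"
    by (subst nn_integral_site_product_split[of _ _ i])
       (auto simp: PiM_off_site nn_integral_measure_pmf mult.assoc[symmetric] weight fun_upd_same
         simp del: fun_upd_apply intro!: nn_integral_cong)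
  finally show "emeasure (density (site_product N) (\<lambda>x. ennreal (w (x i) / c))) A =
      emeasure (site_product (N(i := N'))) A"
    by (simp add: sets_site_product)
qed (simp add: sets_site_product)

lemma integral_update_site:
  assumes "bounded_cylinder \<phi>"
  shows "(\<integral>x. \<phi> (x(i := t (x i))) \<partial>site_product N) = (\<integral>x. \<phi> x \<partial>site_product (N(i := map_pmf t (N i))))"
  using bounded_cylinder_measurable[OF assms]
  by (subst distr_site_product_update[symmetric], subst integral_distr) auto

lemma integral_update_two_sites:
  assumes "bounded_cylinder \<phi>" "i \<noteq> j"
  shows "(\<integral>x. \<phi> (x(i := t (x i), j := s (x j))) \<partial>site_product N) =
    (\<integral>x. \<phi> x \<partial>site_product (N(i := map_pmf t (N i), j := map_pmf s (N j))))"
proof -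
  let ?\<psi> = "\<lambda>x. \<phi> (x(j := s (x j)))"
  have \<psi>: "bounded_cylinder ?\<psi>" by (rule bounded_cylinder_update_site[OF assms(1)])
  have eq: "(\<lambda>x. \<phi> (x(i := t (x i), j := s (x j)))) = (\<lambda>x. ?\<psi> (x(i := t (x i))))"
    using assms(2) by auto
  have "(\<integral>x. ?\<psi> (x(i := t (x i))) \<partial>site_product N) = (\<integral>x. ?\<psi> x \<partial>site_product (N(i := map_pmf t (N i))))"
    by (rule integral_update_site[OF \<psi>])
  also have "\<dots> = (\<integral>x. \<phi> x \<partial>site_product (N(i := map_pmf t (N i), j := map_pmf s (N j))))"
    using integral_update_site[OF assms(1), where i = j and t = s and N = "N(i := map_pmf t (N i))"] assms(2)
    by simp
  finally show "(\<integral>x. \<phi> (x(i := t (x i), j := s (x j))) \<partial>site_product N) =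
    (\<integral>x. \<phi> x \<partial>site_product (N(i := map_pmf t (N i), j := map_pmf s (N j))))"
    unfolding eq .
qed

lemma integral_weight_site:
  assumes "bounded_cylinder \<phi>"
    and "0 < c" "\<And>a. 0 \<le> w a" "\<And>a. w a * pmf (N i) a = c * pmf N' a"
  shows "integrable (site_product N) (\<lambda>x. w (x i) * \<phi> x)" (is ?int)
    and "(\<integral>x. w (x i) * \<phi> x \<partial>site_product N) = c * (\<integral>x. \<phi> x \<partial>site_product (N(i := N')))" (is ?eq)
proof -
  note [measurable] = bounded_cylinder_measurable[OF assms(1)]
  note dens = density_site_product[of c w N i N', OF assms(2,3,4), symmetric]
  have "integrable (density (site_product N) (\<lambda>x. ennreal (w (x i) / c))) \<phi>"
    unfolding dens[symmetric] by (rule bounded_cylinder_integrable[OF assms(1)])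
  then have "integrable (site_product N) (\<lambda>x. w (x i) / c * \<phi> x)"
    using assms(2,3) by (subst (asm) integrable_density) auto
  from integrable_mult_right[OF this, of c] show ?int
    using assms(2) by (simp add: field_simps)
  have "(\<integral>x. \<phi> x \<partial>site_product (N(i := N'))) = (\<integral>x. w (x i) / c * \<phi> x \<partial>site_product N)"
    unfolding dens using assms(2,3) by (subst integral_density) auto
  also have "\<dots> = (\<integral>x. (w (x i) * \<phi> x) / c \<partial>site_product N)" by simp
  also have "\<dots> = (\<integral>x. w (x i) * \<phi> x \<partial>site_product N) / c"
    by (rule integral_divide_zero)
  finally show ?eq using assms(2) by simp
qed

text \<open>The form of every summand of the generator: a rate seen at site \<open>k\<close> times the change of \<open>\<phi>\<close> in a jump
  between \<open>i\<close> and \<open>j\<close>.  The rate is absorbed into the measure first, then the jump is transported to it.\<close>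

lemma has_integral_weighted_jump:
  assumes \<phi>: "bounded_cylinder \<phi>" and "i \<noteq> j"
    and "0 < c" "\<And>a. 0 \<le> w a" "\<And>a. w a * pmf (N k) a = c * pmf N' a"
    and M: "M = N(k := N')"
  shows "has_bochner_integral (site_product N)
    (\<lambda>x. w (x k) * (\<phi> (x(i := t (x i), j := s (x j))) - \<phi> x))
    (c * ((\<integral>x. \<phi> x \<partial>site_product (M(i := map_pmf t (M i), j := map_pmf s (M j))))
          - (\<integral>x. \<phi> x \<partial>site_product M)))"
proof -
  have \<psi>: "bounded_cylinder (\<lambda>x. \<phi> (x(i := t (x i), j := s (x j))) - \<phi> x)"
    by (intro bounded_cylinder_diff bounded_cylinder_update_two_sites \<phi> \<open>i \<noteq> j\<close>)
  show ?thesis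
    unfolding has_bochner_integral_iff
      integral_update_two_sites[OF \<phi> \<open>i \<noteq> j\<close>, symmetric] M
    using integral_weight_site[where \<phi> = "\<lambda>x. \<phi> (x(i := t (x i), j := s (x j))) - \<phi> x"
        and w = w and i = k and N = N and N' = N' and c = c, OF \<psi> assms(3,4,5)]
      bounded_cylinder_integrable[OF \<phi>]
      bounded_cylinder_integrable[OF bounded_cylinder_update_two_sites[OF \<phi> \<open>i \<noteq> j\<close>, of t s]]
    by simp
qed

section \<open>Reduction to a single bond\<close>

text \<open>Written as updates of two sites, the jumps have the form treated by \<open>has_integral_weighted_jump\<close>.\<close>

lemma coupled_generator_term_eq:
  "coupled_generator_term p q \<phi> x i =
    (let u = x i; v = x (i + 1);
         \<psi> = (\<lambda>u' v'. \<phi> (x(i := u', i + 1 := v')) - \<phi> x) in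
       p (fst u) (snd v) * \<psi> (fst u - 1, snd u - 1) (fst v + 1, snd v + 1)
     + (p (fst u) (fst v) - p (fst u) (snd v)) * \<psi> (fst u - 1, snd u) (fst v + 1, snd v)
     + (p (snd u) (snd v) - p (fst u) (snd v)) * \<psi> (fst u, snd u - 1) (fst v, snd v + 1)
     + q (snd u) (fst v) * \<psi> (fst u + 1, snd u + 1) (fst v - 1, snd v - 1)
     + (q (snd u) (snd v) - q (snd u) (fst v)) * \<psi> (fst u, snd u + 1) (fst v, snd v - 1)
     + (q (fst u) (fst v) - q (snd u) (fst v)) * \<psi> (fst u + 1, snd u) (fst v - 1, snd v))"
proof -
  have "pair_config (move i (i+1) (lower x)) (move i (i+1) (upper x)) =
        x(i := (fst (x i) - 1, snd (x i) - 1), i+1 := (fst (x (i+1)) + 1, snd (x (i+1)) + 1))"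
    "pair_config (move i (i+1) (lower x)) (upper x) =
        x(i := (fst (x i) - 1, snd (x i)), i+1 := (fst (x (i+1)) + 1, snd (x (i+1))))"
    "pair_config (lower x) (move i (i+1) (upper x)) =
        x(i := (fst (x i), snd (x i) - 1), i+1 := (fst (x (i+1)), snd (x (i+1)) + 1))"
    "pair_config (move (i+1) i (lower x)) (move (i+1) i (upper x)) =
        x(i := (fst (x i) + 1, snd (x i) + 1), i+1 := (fst (x (i+1)) - 1, snd (x (i+1)) - 1))"
    "pair_config (lower x) (move (i+1) i (upper x)) =
        x(i := (fst (x i), snd (x i) + 1), i+1 := (fst (x (i+1)), snd (x (i+1)) - 1))"
    "pair_config (move (i+1) i (lower x)) (upper x) =
        x(i := (fst (x i) + 1, snd (x i)), i+1 := (fst (x (i+1)) - 1, snd (x (i+1))))"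
    by (auto simp: fun_eq_iff pair_config_def move_def lower_def upper_def)
  then show ?thesis
    by (simp add: coupled_generator_term_def Let_def lower_def upper_def)
qed

lemma coupled_generator_term_eq_0:
  assumes "\<And>x y. (\<forall>j\<in>J. x j = y j) \<Longrightarrow> \<phi> x = \<phi> y" "i \<notin> J" "i + 1 \<notin> J"
  shows "coupled_generator_term p q \<phi> x i = 0"
proof -
  have "\<phi> (x(i := a, i + 1 := b)) = \<phi> x" for a b
    using assms(2,3) by (intro assms(1)) auto
  then show ?thesis
    by (simp add: coupled_generator_term_eq)
qed

text \<open>The identity has to be checked only bond by bond and up to a gradient, which vanishes far from the
  support of \<open>\<phi>\<close> and hence telescopes to zero.  The same localisation makes the sum over \<open>i\<close> finite.\<close>

lemma shock_evolution_telescope: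
  fixes T :: "(coupled_config \<Rightarrow> real) \<Rightarrow> int \<Rightarrow> real"
  assumes dyn: "coupled_dynamics I p q (shock_measure \<mu> \<sigma> m) S"
    and int: "\<And>\<phi> i. bounded_cylinder \<phi> \<Longrightarrow>
      integrable (shock_measure \<mu> \<sigma> m) (\<lambda>x. coupled_generator_term p q \<phi> x i)"
    and loc: "\<And>\<phi> i. bounded_cylinder \<phi> \<Longrightarrow>
      (\<integral>x. coupled_generator_term p q \<phi> x i \<partial>shock_measure \<mu> \<sigma> m) =
        shock_term \<mu> \<sigma> m P Q \<sigma>R \<sigma>L \<phi> i + (T \<phi> (i + 1) - T \<phi> i)"
    and T: "\<And>\<phi> i. bounded_cylinder \<phi> \<Longrightarrow> (\<And>x a. \<phi> (x(i := a)) = \<phi> x) \<Longrightarrow> T \<phi> i = 0"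
  shows "shock_evolution p q S \<mu> \<sigma> m P Q \<sigma>R \<sigma>L"
  unfolding shock_evolution_def
proof (intro allI impI)
  fix \<phi> assume \<phi>: "bounded_cylinder \<phi>"
  let ?\<nu> = "shock_measure \<mu> \<sigma> m" and ?s = "shock_term \<mu> \<sigma> m P Q \<sigma>R \<sigma>L \<phi>"
  from \<phi> obtain J where J: "finite J" "\<And>x y. (\<forall>j\<in>J. x j = y j) \<Longrightarrow> \<phi> x = \<phi> y"
    unfolding bounded_cylinder_def by blast
  \<comment> \<open>Left ends of the bonds that meet \<open>J\<close>; adding \<open>J\<close> itself makes \<open>K\<close> contain every site where \<open>T\<close> lives.\<close>
  define K where "K = J \<union> (\<lambda>j. j - 1) ` J"
  have K: "finite K" using J(1) by (simp add: K_def)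
  have notK: "i \<notin> J \<and> i + 1 \<notin> J" if "i \<notin> K" for i
    using that by (auto simp: K_def image_iff)
  have T0: "T \<phi> i = 0" if "i \<notin> J" for i
    using that by (intro T \<phi> J(2)) auto
  have term0: "coupled_generator_term p q \<phi> x i = 0" if "i \<notin> K" for x i
    using notK[OF that] by (intro coupled_generator_term_eq_0[of J]) (auto intro: J(2))
  have s0: "?s i = 0" if "i \<notin> K" for i
    using loc[OF \<phi>, of i] term0[OF that] T0 notK[OF that] by simp
  have gen: "coupled_generator p q \<phi> = (\<lambda>x. \<Sum>i\<in>K. coupled_generator_term p q \<phi> x i)"
  proof
    fix x
    have "coupled_generator p q \<phi> x = (\<Sum>\<^sub>\<infinity>i\<in>K. coupled_generator_term p q \<phi> x i)"
      unfolding coupled_generator_def using term0 by (intro infsum_cong_neutral) auto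
    then show "coupled_generator p q \<phi> x = (\<Sum>i\<in>K. coupled_generator_term p q \<phi> x i)"
      using K by simp
  qed
  have integrable: "integrable ?\<nu> (coupled_generator p q \<phi>)"
    unfolding gen using int[OF \<phi>] by auto
  have "(\<Sum>i\<in>K. T \<phi> (i + 1)) = (\<Sum>i\<in>(\<lambda>j. j - 1) ` J. T \<phi> (i + 1))"
    using K T0 by (intro sum.mono_neutral_right) (force simp: K_def image_iff)+
  also have "\<dots> = (\<Sum>i\<in>J. T \<phi> i)"
    by (subst sum.reindex) (auto simp: inj_on_def)
  also have "\<dots> = (\<Sum>i\<in>K. T \<phi> i)"
    using K T0 by (intro sum.mono_neutral_left) (auto simp: K_def)
  finally have tele: "(\<Sum>i\<in>K. T \<phi> (i + 1) - T \<phi> i) = 0"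
    by (simp add: sum_subtractf)
  have "(\<integral>x. coupled_generator p q \<phi> x \<partial>?\<nu>) = (\<Sum>i\<in>K. \<integral>x. coupled_generator_term p q \<phi> x i \<partial>?\<nu>)"
    unfolding gen using int[OF \<phi>] by (intro Bochner_Integration.integral_sum)
  also have "\<dots> = (\<Sum>i\<in>K. ?s i)"
    using tele by (simp add: loc[OF \<phi>] sum.distrib)
  finally have "(\<integral>x. coupled_generator p q \<phi> x \<partial>?\<nu>) = (\<Sum>i\<in>K. ?s i)" .
  moreover have "(?s has_sum (\<Sum>i\<in>K. ?s i)) UNIV"
    using K s0 by (intro has_sum_finite_neutralI) auto
  ultimately have sum: "(?s has_sum (\<integral>x. coupled_generator p q \<phi> x \<partial>?\<nu>)) UNIV"
    by simp
  then have "(\<Sum>\<^sub>\<infinity>i\<in>UNIV. ?s i) = (\<integral>x. coupled_generator p q \<phi> x \<partial>?\<nu>)"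
    by (rule infsumI)
  with dyn \<phi> integrable sum
  show "integrable ?\<nu> (coupled_generator p q \<phi>) \<and>
      (?s has_sum (\<integral>x. coupled_generator p q \<phi> x \<partial>?\<nu>)) UNIV \<and>
      ((\<lambda>t. \<integral>x. \<phi> x \<partial>(?\<nu> \<bind> S t)) has_real_derivative (\<Sum>\<^sub>\<infinity>i\<in>UNIV. ?s i)) (at 0 within {0..})"
    unfolding coupled_dynamics_def by simp
qed

section \<open>Zero range and bricklayers processes\<close>

lemma map_pair_law:
  assumes "\<And>y. t (y, y + int k) = (y + d, y + d + int k')"
  shows "map_pmf t (pair_law M k) = pair_law (map_pmf (\<lambda>y. y + d) M) k'"
  by (simp add: pair_law_def map_pmf_comp assms)

text \<open>Tilting by a function of the pair reduces to tilting the law of the lower coordinate, because the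
  law lives on the line \<open>z = y + k\<close>.\<close>

lemma weight_pair_law:
  assumes "\<And>y. w (y, y + int k) * pmf M y = c * pmf M' y"
  shows "w a * pmf (pair_law M k) a = c * pmf (pair_law M' k) a"
proof (cases "a \<in> range (\<lambda>y. (y, y + int k))")
  case True
  then obtain y where a: "a = (y, y + int k)" by auto
  have "pmf (pair_law L k) a = pmf L y" for L
    unfolding pair_law_def a by (rule pmf_map_inj'[of "\<lambda>y. (y, y + int k)"]) (simp add: inj_def)
  then show ?thesis
    using assms by (simp add: a)
next
  case False
  then have "pmf (pair_law L k) a = 0" for L
    by (auto simp: pair_law_def pmf_eq_0_set_pmf)
  then show ?thesis by simp
qed

text \<open>Completing the square: passing from \<open>\<sigma>\<close> to \<open>\<sigma> + \<beta>\<close> moves the centre of the discrete Gaussian by one,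
  and the normalising sums differ by the same constant factor as the unnormalised weights.\<close>

lemma stationary_weight_shift: "stationary_weight \<beta> (\<sigma> + \<beta>) y = stationary_weight \<beta> \<sigma> (y - 1)"
proof -
  define h where "h = (\<lambda>s (y::int). exp (s * real_of_int y - \<beta> * (real_of_int y)\<^sup>2 / 2))"
  have h: "h (\<sigma> + \<beta>) y = exp (\<sigma> + \<beta> / 2) * h \<sigma> (y - 1)" for y
    by (simp add: h_def power2_eq_square field_simps flip: exp_add)
  have "(\<Sum>\<^sub>\<infinity>y\<in>UNIV. h (\<sigma> + \<beta>) y) = exp (\<sigma> + \<beta> / 2) * (\<Sum>\<^sub>\<infinity>y\<in>UNIV. h \<sigma> (y - 1))"
    unfolding h by (rule infsum_cmult_right')
  also have "(\<Sum>\<^sub>\<infinity>y\<in>UNIV. h \<sigma> (y - 1)) = (\<Sum>\<^sub>\<infinity>y\<in>UNIV. h \<sigma> y)"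
    by (rule infsum_reindex_bij_betw) (auto intro: bij_betw_byWitness[where f' = "\<lambda>y. y + 1"])
  finally have "h (\<sigma> + \<beta>) y / (\<Sum>\<^sub>\<infinity>y\<in>UNIV. h (\<sigma> + \<beta>) y) = h \<sigma> (y - 1) / (\<Sum>\<^sub>\<infinity>y\<in>UNIV. h \<sigma> y)"
    by (simp add: h)
  then show ?thesis
    by (simp add: stationary_weight_def h_def)
qed

text \<open>Detailed-balance form of the rates: the jump rate times the stationary weight is, up to the factor
  \<open>e\<^sup>\<sigma>\<close> or \<open>e\<^sup>-\<^sup>\<sigma>\<close>, the weight at the state after the jump, hence the weight for the shifted parameter.\<close>

lemma exp_rate_stationary_weight:
  "exp_rate \<beta> y * stationary_weight \<beta> \<sigma> y = exp \<sigma> * stationary_weight \<beta> (\<sigma> + \<beta>) y"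
  "exp_rate \<beta> (- y) * stationary_weight \<beta> \<sigma> y = exp (- \<sigma>) * stationary_weight \<beta> (\<sigma> - \<beta>) y"
proof -
  have "exp_rate \<beta> y * stationary_weight \<beta> \<sigma> y = exp \<sigma> * stationary_weight \<beta> \<sigma> (y - 1)"
    by (simp add: exp_rate_def stationary_weight_def power2_eq_square field_simps flip: exp_add)
  then show "exp_rate \<beta> y * stationary_weight \<beta> \<sigma> y = exp \<sigma> * stationary_weight \<beta> (\<sigma> + \<beta>) y"
    by (simp add: stationary_weight_shift)
  have "exp_rate \<beta> (- y) * stationary_weight \<beta> \<sigma> y = exp (- \<sigma>) * stationary_weight \<beta> \<sigma> (y + 1)"
    by (simp add: exp_rate_def stationary_weight_def power2_eq_square field_simps flip: exp_add)
  then show "exp_rate \<beta> (- y) * stationary_weight \<beta> \<sigma> y = exp (- \<sigma>) * stationary_weight \<beta> (\<sigma> - \<beta>) y"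
    using stationary_weight_shift[of \<beta> "\<sigma> - \<beta>" "y + 1"] by simp
qed

lemma exp_rate_add: "exp_rate \<beta> (y + int k) = exp (\<beta> * real k) * exp_rate \<beta> y"
  by (simp add: exp_rate_def algebra_simps flip: exp_add)

text \<open>Both exponential models at once: \<open>\<kappa> = 0\<close> is the zero range process, \<open>\<kappa> = 1\<close> the bricklayers process.\<close>

lemma exponential_shock_evolution:
  fixes \<kappa> :: real
  assumes p: "\<And>y z. p y z = exp_rate \<beta> y + \<kappa> * exp_rate \<beta> (- z)"
    and \<sigma>: "\<And>i. \<sigma> (i - 1) - \<sigma> i = \<beta> * real (m i)"
    and \<mu>: "\<And>s k y. pmf (\<mu> s k) y = stationary_weight \<beta> s y"
    and dyn: "coupled_dynamics I p zero_rate (shock_measure \<mu> \<sigma> m) S"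
  shows "shock_evolution p zero_rate S \<mu> \<sigma> m
           (\<lambda>k l r s. exp (r + \<beta> * real k) - exp r)
           (\<lambda>k l r s. \<kappa> * (exp (- s) - exp (- s - \<beta> * real l)))
           (\<lambda>i. \<sigma>(i := \<sigma> i + \<beta>))
           (\<lambda>i. \<sigma>(i := \<sigma> i - \<beta>))"
proof -
  define L where "L s k = pair_law (\<mu> s k) k" for s k
  define N where "N = (\<lambda>i. L (\<sigma> i) (m i))"
  define E where "E \<phi> M = (\<integral>x. \<phi> x \<partial>site_product M)" for \<phi> :: "coupled_config \<Rightarrow> real" and M
  define T where "T \<phi> i =
      exp (\<sigma> i + \<beta> * real (m i)) * (E \<phi> (N(i := L (\<sigma> i + \<beta>) (m i))) - E \<phi> N)
      - \<kappa> * exp (- \<sigma> i) * (E \<phi> (N(i := L (\<sigma> i - \<beta>) (m i))) - E \<phi> N)" for \<phi> i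
  let ?P = "\<lambda>k (l::nat) r (s::real). exp (r + \<beta> * real k) - exp r"
  let ?Q = "\<lambda>(k::nat) l (r::real) s. \<kappa> * (exp (- s) - exp (- s - \<beta> * real l))"
  have shock: "shock_measure \<mu> \<sigma>' m' = site_product (\<lambda>i. L (\<sigma>' i) (m' i))" for \<sigma>' m'
    by (simp add: shock_measure_eq L_def)
  have indep: "\<mu> s k = \<mu> s k'" for s k k'
    by (intro pmf_eqI) (simp add: \<mu>)
  have up: "map_pmf (\<lambda>y. y + 1) (\<mu> s k) = \<mu> (s + \<beta>) k'" for s k k'
  proof (rule pmf_eqI)
    fix y
    have "pmf (map_pmf (\<lambda>y. y + 1) (\<mu> s k)) (y - 1 + 1) = pmf (\<mu> s k) (y - 1)"
      by (rule pmf_map_inj') (simp add: inj_def)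
    then show "pmf (map_pmf (\<lambda>y. y + 1) (\<mu> s k)) y = pmf (\<mu> (s + \<beta>) k') y"
      by (simp add: \<mu> stationary_weight_shift)
  qed
  have down: "map_pmf (\<lambda>y. y + - 1) (\<mu> s k) = \<mu> (s - \<beta>) k'" for s k k'
  proof -
    have "map_pmf (\<lambda>y. y + - 1) (map_pmf (\<lambda>y. y + 1) (\<mu> (s - \<beta>) k')) = \<mu> (s - \<beta>) k'"
      by (simp add: map_pmf_comp)
    then show ?thesis
      by (simp add: up[of "s - \<beta>" k' k])
  qed
  have stay: "map_pmf (\<lambda>y. y + 0) (\<mu> s k) = \<mu> s k'" for s k k'
    by (simp add: indep[of s k k'])
  have map_up: "map_pmf t (L s k) = L (s + \<beta>) k'"
    if "\<And>y. t (y, y + int k) = (y + 1, y + 1 + int k')" for t s k k'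
    unfolding L_def by (simp add: map_pair_law[OF that] up[of s k k'])
  have map_down: "map_pmf t (L s k) = L (s - \<beta>) k'"
    if "\<And>y. t (y, y + int k) = (y + - 1, y + - 1 + int k')" for t s k k'
    unfolding L_def by (subst map_pair_law[OF that]) (simp only: down[of s k k'])
  have map_stay: "map_pmf t (L s k) = L s k'"
    if "\<And>y. t (y, y + int k) = (y + 0, y + 0 + int k')" for t s k k'
    unfolding L_def by (subst map_pair_law[OF that]) (simp only: stay[of s k k'])
  have weight:
    "exp_rate \<beta> (fst a) * pmf (L s k) a = exp s * pmf (L (s + \<beta>) k) a"
    "exp_rate \<beta> (snd a) * pmf (L s k) a = exp (s + \<beta> * real k) * pmf (L (s + \<beta>) k) a"
    "exp_rate \<beta> (- fst a) * pmf (L s k) a = exp (- s) * pmf (L (s - \<beta>) k) a"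
    "exp_rate \<beta> (- snd a) * pmf (L s k) a = exp (- s - \<beta> * real k) * pmf (L (s - \<beta>) k) a"
    for s k a
    subgoal unfolding L_def by (rule weight_pair_law) (simp add: \<mu> exp_rate_stationary_weight)
    subgoal unfolding L_def
      by (rule weight_pair_law) (simp add: \<mu> exp_rate_stationary_weight exp_rate_add exp_add mult.assoc)
    subgoal unfolding L_def by (rule weight_pair_law) (simp add: \<mu> exp_rate_stationary_weight)
    subgoal unfolding L_def
    proof (rule weight_pair_law)
      fix y
      have "exp_rate \<beta> (- y) = exp (\<beta> * real k) * exp_rate \<beta> (- (y + int k))"
        using exp_rate_add[of \<beta> "- (y + int k)" k] by simp
      then have "exp_rate \<beta> (- (y + int k)) = exp (- (\<beta> * real k)) * exp_rate \<beta> (- y)"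
        by (simp add: exp_minus)
      then show "exp_rate \<beta> (- snd (y, y + int k)) * pmf (\<mu> s k) y =
          exp (- s - \<beta> * real k) * pmf (\<mu> (s - \<beta>) k) y"
        using exp_rate_stationary_weight(2)[of \<beta> y s]
        by (simp add: \<mu> exp_diff exp_minus field_simps)
    qed
    done
  have rate_nonneg: "0 \<le> exp_rate \<beta> y" for y
    by (simp add: exp_rate_def)
  have local_identity: "has_bochner_integral (site_product N)
      (\<lambda>x. coupled_generator_term p zero_rate \<phi> x i)
      (shock_term \<mu> \<sigma> m ?P ?Q (\<lambda>i. \<sigma>(i := \<sigma> i + \<beta>)) (\<lambda>i. \<sigma>(i := \<sigma> i - \<beta>)) \<phi> i
       + (T \<phi> (i + 1) - T \<phi> i))"
    if \<phi>: "bounded_cylinder \<phi>" for \<phi> i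
  proof -
    let ?u = "\<sigma> i" and ?v = "\<sigma> (i + 1)" and ?k = "m i" and ?l = "m (i + 1)"
    \<comment> \<open>Every part of the generator integrates to values of \<open>F\<close>: only the laws at the two sites change.\<close>
    define F where "F A B = E \<phi> (N(i := A, i + 1 := B))" for A B
    \<comment> \<open>Laws after a second class particle has left.  Without such a particle they are not of the form
      \<open>L s k\<close>, but then they only occur with coefficient zero.\<close>
    define Y where "Y = map_pmf (\<lambda>a. (fst a, snd a - 1)) (L (?u + \<beta>) ?k)"
    define X where "X = map_pmf (\<lambda>a. (fst a + 1, snd a)) (L (?v - \<beta>) ?l)"
    have ij: "i \<noteq> i + 1" by simp
    have N_at: "N i = L ?u ?k" "N (i + 1) = L ?v ?l"
      by (simp_all add: N_def)
    have fill: "N(i := A, i + 1 := L ?v ?l) = N(i := A)" "N(i := L ?u ?k, i + 1 := B) = N(i + 1 := B)"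
      "N(i + 1 := B, i := A) = N(i := A, i + 1 := B)" for A B
      by (auto simp: N_def)
    have tilt_i: "has_bochner_integral (site_product N)
        (\<lambda>x. exp_rate \<beta> (f (x i)) * (\<phi> (x(i := t (x i), i + 1 := s (x (i + 1)))) - \<phi> x))
        (c * (F (map_pmf t (L (?u + \<beta>) ?k)) (map_pmf s (L ?v ?l)) - F (L (?u + \<beta>) ?k) (L ?v ?l)))"
      if "(f, c) \<in> {(fst, exp ?u), (snd, exp (?u + \<beta> * real ?k))}" for f c t s
      using that weight(1,2)[where s = ?u and k = ?k]
        has_integral_weighted_jump[OF \<phi> ij, where w = "\<lambda>a. exp_rate \<beta> (f a)" and k = i and N = N and c = c
          and N' = "L (?u + \<beta>) ?k" and t = t and s = s, OF _ _ _ refl]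
      by (auto simp: rate_nonneg N_at fill F_def E_def)
    have tilt_j: "has_bochner_integral (site_product N)
        (\<lambda>x. exp_rate \<beta> (- f (x (i + 1))) * (\<phi> (x(i := t (x i), i + 1 := s (x (i + 1)))) - \<phi> x))
        (c * (F (map_pmf t (L ?u ?k)) (map_pmf s (L (?v - \<beta>) ?l)) - F (L ?u ?k) (L (?v - \<beta>) ?l)))"
      if "(f, c) \<in> {(fst, exp (- ?v)), (snd, exp (- ?v - \<beta> * real ?l))}" for f c t s
      using that weight(3,4)[where s = ?v and k = ?l]
        has_integral_weighted_jump[OF \<phi> ij, where w = "\<lambda>a. exp_rate \<beta> (- f a)" and k = "i + 1" and N = N and c = c
          and N' = "L (?v - \<beta>) ?l" and t = t and s = s, OF _ _ _ refl]
      by (auto simp: rate_nonneg N_at fill F_def E_def)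
    let ?both_i = "\<lambda>a. (fst a - 1, snd a - 1)" and ?both_j = "\<lambda>a. (fst a + 1, snd a + 1)"
    let ?low_i = "\<lambda>a. (fst a - 1, snd a)" and ?low_j = "\<lambda>a. (fst a + 1, snd a)"
    let ?upp_i = "\<lambda>a. (fst a, snd a - 1)" and ?upp_j = "\<lambda>a. (fst a, snd a + 1)"
    have maps: "map_pmf ?both_i (L (?u + \<beta>) ?k) = L ?u ?k" "map_pmf ?both_j (L ?v ?l) = L (?v + \<beta>) ?l"
      "map_pmf ?both_i (L ?u ?k) = L (?u - \<beta>) ?k" "map_pmf ?both_j (L (?v - \<beta>) ?l) = L ?v ?l"
      "map_pmf ?low_i (L ?u ?k) = L (?u - \<beta>) (?k + 1)"
      "map_pmf ?upp_j (L ?v ?l) = L ?v (?l + 1)"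
      using map_down[of ?both_i ?k ?k "?u + \<beta>"] map_up[of ?both_j ?l ?l ?v]
        map_down[of ?both_i ?k ?k ?u] map_up[of ?both_j ?l ?l "?v - \<beta>"]
        map_down[of ?low_i ?k "?k + 1" ?u] map_stay[of ?upp_j ?l "?l + 1" ?v]
      by simp_all
    have X: "X = L ?v (?l - 1)" if "?l > 0"
      using that map_up[of ?low_j ?l "?l - 1" "?v - \<beta>"] by (simp add: X_def of_nat_diff)
    have Y: "Y = L (?u + \<beta>) (?k - 1)" if "?k > 0"
      using that map_stay[of ?upp_i ?k "?k - 1" "?u + \<beta>"] by (simp add: Y_def of_nat_diff)
    \<comment> \<open>The rates of the six parts, up to the factor \<open>\<kappa>\<close>: \<open>f(\<omega>\<^sub>i)\<close> and \<open>f(-\<zeta>\<^sub>i\<^sub>+\<^sub>1)\<close> for the joint jump,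
      \<open>f(-\<omega>\<^sub>i\<^sub>+\<^sub>1) - f(-\<zeta>\<^sub>i\<^sub>+\<^sub>1)\<close> for the lower one alone, \<open>f(\<zeta>\<^sub>i) - f(\<omega>\<^sub>i)\<close> for the upper one alone.  The
      differences are integrated term by term, since each term is a tilt by a positive weight, whereas
      the difference may vanish.\<close>
    let ?c = "exp (- ?v - \<beta> * real ?l)"
    have scale: "has_bochner_integral (site_product N) (\<lambda>x. \<kappa> * f x) (\<kappa> * r)"
      if "has_bochner_integral (site_product N) f r" for f r
      using that by (rule has_bochner_integral_mult_right)
    have cases: "(fst, exp ?u) \<in> {(fst, exp ?u), (snd, exp (?u + \<beta> * real ?k))}"
      "(snd, exp (?u + \<beta> * real ?k)) \<in> {(fst, exp ?u), (snd, exp (?u + \<beta> * real ?k))}"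
      "(fst, exp (- ?v)) \<in> {(fst, exp (- ?v)), (snd, ?c)}" "(snd, ?c) \<in> {(fst, exp (- ?v)), (snd, ?c)}"
      by auto
    note b1 = tilt_i[OF cases(1), where t = ?both_i and s = ?both_j]
    note b2 = scale[OF tilt_j[OF cases(4), where t = ?both_i and s = ?both_j]]
    note b3 = scale[OF tilt_j[OF cases(3), where t = ?low_i and s = ?low_j]]
    note b4 = scale[OF tilt_j[OF cases(4), where t = ?low_i and s = ?low_j]]
    note b5 = tilt_i[OF cases(2), where t = ?upp_i and s = ?upp_j]
    note b6 = tilt_i[OF cases(1), where t = ?upp_i and s = ?upp_j]
    note parts = has_bochner_integral_diff[OF has_bochner_integral_add[OF has_bochner_integral_diff[OF
        has_bochner_integral_add[OF has_bochner_integral_add[OF b1 b2] b3] b4] b5] b6]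
    have generator: "has_bochner_integral (site_product N) (\<lambda>x. coupled_generator_term p zero_rate \<phi> x i)
       (exp ?u * (F (L ?u ?k) (L (?v + \<beta>) ?l) - F (L (?u + \<beta>) ?k) (L ?v ?l))
        + \<kappa> * (?c * (F (L (?u - \<beta>) ?k) (L ?v ?l) - F (L ?u ?k) (L (?v - \<beta>) ?l)))
        + \<kappa> * (exp (- ?v) * (F (L (?u - \<beta>) (?k + 1)) X - F (L ?u ?k) (L (?v - \<beta>) ?l)))
        - \<kappa> * (?c * (F (L (?u - \<beta>) (?k + 1)) X - F (L ?u ?k) (L (?v - \<beta>) ?l)))
        + exp (?u + \<beta> * real ?k) * (F Y (L ?v (?l + 1)) - F (L (?u + \<beta>) ?k) (L ?v ?l))
        - exp ?u * (F Y (L ?v (?l + 1)) - F (L (?u + \<beta>) ?k) (L ?v ?l)))"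
      using parts unfolding maps X_def[symmetric] Y_def[symmetric]
      by (simp add: coupled_generator_term_eq Let_def zero_rate_def p algebra_simps)
    have EN: "E \<phi> N = F (L ?u ?k) (L ?v ?l)"
      by (simp add: F_def N_def fun_upd_idem)
    have T_i: "T \<phi> i =
        exp (?u + \<beta> * real ?k) * (F (L (?u + \<beta>) ?k) (L ?v ?l) - F (L ?u ?k) (L ?v ?l))
        - \<kappa> * exp (- ?u) * (F (L (?u - \<beta>) ?k) (L ?v ?l) - F (L ?u ?k) (L ?v ?l))"
      by (simp add: T_def F_def N_def fun_upd_idem)
    have T_j: "T \<phi> (i + 1) =
        exp ?u * (F (L ?u ?k) (L (?v + \<beta>) ?l) - F (L ?u ?k) (L ?v ?l))
        - \<kappa> * exp (- ?v) * (F (L ?u ?k) (L (?v - \<beta>) ?l) - F (L ?u ?k) (L ?v ?l))"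
      using \<sigma>[of "i + 1"] by (simp add: T_def F_def N_def fun_upd_idem algebra_simps)
    have right: "?P ?k ?l ?u ?v * E \<phi> (\<lambda>j. L ((\<sigma>(i := ?u + \<beta>)) j) (move i (i + 1) m j)) =
        ?P ?k ?l ?u ?v * F Y (L ?v (?l + 1))"
    proof (cases "?k = 0")
      case False
      then have "(\<lambda>j. L ((\<sigma>(i := ?u + \<beta>)) j) (move i (i + 1) m j)) = N(i := Y, i + 1 := L ?v (?l + 1))"
        by (auto simp: Y N_def move_def fun_eq_iff)
      then show ?thesis
        by (simp add: F_def)
    qed simp
    have left: "?Q ?k ?l ?u ?v * E \<phi> (\<lambda>j. L ((\<sigma>(i := ?u - \<beta>)) j) (move (i + 1) i m j)) =
        ?Q ?k ?l ?u ?v * F (L (?u - \<beta>) (?k + 1)) X"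
    proof (cases "?l = 0")
      case False
      then have "(\<lambda>j. L ((\<sigma>(i := ?u - \<beta>)) j) (move (i + 1) i m j)) = N(i := L (?u - \<beta>) (?k + 1), i + 1 := X)"
        by (auto simp: X N_def move_def fun_eq_iff)
      then show ?thesis
        by (simp add: F_def)
    qed simp
    \<comment> \<open>This and \<open>T_j\<close> are the places where the relation between neighbouring parameters enters.\<close>
    have c: "?c = exp (- ?u)"
      using \<sigma>[of "i + 1"] by (simp add: algebra_simps)
    have shock_i: "shock_term \<mu> \<sigma> m ?P ?Q (\<lambda>i. \<sigma>(i := \<sigma> i + \<beta>)) (\<lambda>i. \<sigma>(i := \<sigma> i - \<beta>)) \<phi> i =
        ?P ?k ?l ?u ?v * (F Y (L ?v (?l + 1)) - E \<phi> N) + ?Q ?k ?l ?u ?v * (F (L (?u - \<beta>) (?k + 1)) X - E \<phi> N)"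
      unfolding shock_term_def shock N_def[symmetric] E_def[symmetric] right_diff_distrib[of "?P _ _ _ _"]
        right_diff_distrib[of "?Q _ _ _ _"] right left ..
    show ?thesis
      by (rule back_subst[where P = "has_bochner_integral _ _", OF generator])
         (unfold shock_i T_i T_j EN c, simp only: algebra_simps)
  qed
  show ?thesis
  proof (rule shock_evolution_telescope[OF dyn, where T = T])
    fix \<phi> i assume \<phi>: "bounded_cylinder \<phi>"
    note loc = local_identity[OF \<phi>, of i]
    show "integrable (shock_measure \<mu> \<sigma> m) (\<lambda>x. coupled_generator_term p zero_rate \<phi> x i)"
      using loc by (simp add: shock N_def has_bochner_integral_iff)
    show "(\<integral>x. coupled_generator_term p zero_rate \<phi> x i \<partial>shock_measure \<mu> \<sigma> m) =
        shock_term \<mu> \<sigma> m ?P ?Q (\<lambda>i. \<sigma>(i := \<sigma> i + \<beta>)) (\<lambda>i. \<sigma>(i := \<sigma> i - \<beta>)) \<phi> i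
        + (T \<phi> (i + 1) - T \<phi> i)"
      using loc by (simp add: shock N_def has_bochner_integral_iff)
    assume flat: "\<And>x a. \<phi> (x(i := a)) = \<phi> x"
    \<comment> \<open>Overwriting site \<open>i\<close> leaves \<open>\<phi>\<close> unchanged and erases the difference between the two laws.\<close>
    have E: "E \<phi> (N(i := A)) = E \<phi> N" for A
      using integral_update_site[OF \<phi>, where i = i and t = "\<lambda>_. undefined" and N = N]
        integral_update_site[OF \<phi>, where i = i and t = "\<lambda>_. undefined" and N = "N(i := A)"]
      by (simp add: E_def flat)
    show "T \<phi> i = 0"
      by (simp add: T_def E)
  qed
qed

section \<open>Simple exclusion process\<close>

lemma bounded_cylinder_generator_term:
  assumes "bounded_cylinder \<phi>"
    and p: "\<And>y z. \<bar>p y z\<bar> \<le> C" and q: "\<And>y z. \<bar>q y z\<bar> \<le> C"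
  shows "bounded_cylinder (\<lambda>x. coupled_generator_term p q \<phi> x i)"
proof -
  have jump: "bounded_cylinder (\<lambda>x. \<phi> (x(i := t (x i), i + 1 := s (x (i + 1)))) - \<phi> x)" for t s
    by (intro bounded_cylinder_diff bounded_cylinder_update_two_sites assms(1)) simp
  have rate: "bounded_cylinder (\<lambda>x. p (f (x i)) (g (x (i + 1))))"
    "bounded_cylinder (\<lambda>x. q (f (x i)) (g (x (i + 1))))" for f g
    using p q by (auto intro!: bounded_cylinder_two_sites boundedI)
  show ?thesis
    unfolding coupled_generator_term_eq Let_def
    by (intro bounded_cylinder_add bounded_cylinder_mult bounded_cylinder_diff[OF rate(1) rate(1)]
        bounded_cylinder_diff[OF rate(2) rate(2)] rate jump)
qed

text \<open>Pinning site \<open>i\<close> to \<open>a\<close> is tilting by the indicator of \<open>a\<close>, and the indicators of the finitely many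
  possible states add up to one almost surely.\<close>

lemma integral_finite_support_site:
  assumes \<phi>: "bounded_cylinder \<phi>" and fin: "finite (set_pmf (N i))"
  shows "(\<integral>x. \<phi> x \<partial>site_product N) = (\<Sum>a\<in>set_pmf (N i). pmf (N i) a * (\<integral>x. \<phi> (x(i := a)) \<partial>site_product N))"
proof -
  have single: "integrable (site_product N) (\<lambda>x. indicat_real {a} (x i) * \<phi> x)"
    "(\<integral>x. indicat_real {a} (x i) * \<phi> x \<partial>site_product N) = pmf (N i) a * (\<integral>x. \<phi> (x(i := a)) \<partial>site_product N)"
    if "a \<in> set_pmf (N i)" for a
  proof -
    have "0 < pmf (N i) a" using that by (simp add: pmf_positive_iff)
    note * = integral_weight_site[where w = "indicat_real {a}" and N' = "return_pmf a" and N = N and i = i, OF \<phi> this]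
    show "integrable (site_product N) (\<lambda>x. indicat_real {a} (x i) * \<phi> x)"
      by (rule *) (auto simp: indicator_def)
    have "(\<integral>x. indicat_real {a} (x i) * \<phi> x \<partial>site_product N) =
        pmf (N i) a * (\<integral>x. \<phi> x \<partial>site_product (N(i := return_pmf a)))"
      by (rule *) (auto simp: indicator_def)
    also have "(\<integral>x. \<phi> x \<partial>site_product (N(i := return_pmf a))) = (\<integral>x. \<phi> (x(i := a)) \<partial>site_product N)"
      using integral_update_site[OF \<phi>, where t = "\<lambda>_. a" and i = i and N = N] by simp
    finally show "(\<integral>x. indicat_real {a} (x i) * \<phi> x \<partial>site_product N) =
        pmf (N i) a * (\<integral>x. \<phi> (x(i := a)) \<partial>site_product N)" .
  qed
  have "AE x in site_product N. x i \<in> set_pmf (N i)"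
    unfolding site_product_def
    by (rule AE_PiM_component) (auto simp: prob_space_measure_pmf AE_measure_pmf)
  then have "AE x in site_product N. \<phi> x = (\<Sum>a\<in>set_pmf (N i). indicat_real {a} (x i) * \<phi> x)"
  proof eventually_elim
    case (elim x)
    then show ?case
      using fin by (simp add: indicator_def if_distrib[of "\<lambda>r. r * _"] sum.delta cong: if_cong)
  qed
  then have "(\<integral>x. \<phi> x \<partial>site_product N) = (\<integral>x. (\<Sum>a\<in>set_pmf (N i). indicat_real {a} (x i) * \<phi> x) \<partial>site_product N)"
    using single(1) bounded_cylinder_integrable[OF \<phi>, of N]
    by (intro integral_cong_AE borel_measurable_sum) (auto dest: borel_measurable_integrable)
  also have "\<dots> = (\<Sum>a\<in>set_pmf (N i). pmf (N i) a * (\<integral>x. \<phi> (x(i := a)) \<partial>site_product N))"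
    using single by (subst Bochner_Integration.integral_sum) auto
  finally show ?thesis .
qed

text \<open>The two laws \<open>N\<close> and \<open>N'\<close> agree off the two sites, so shock measures before and after a jump are expanded
  in the same integrals of \<open>\<phi>\<close> with pinned states, with different weights.\<close>

lemma integral_finite_support_two_sites:
  assumes \<phi>: "bounded_cylinder \<phi>" and ij: "i \<noteq> j"
    and fin: "finite (set_pmf (N' i))" "finite (set_pmf (N' j))"
    and N': "\<And>k. k \<noteq> i \<Longrightarrow> k \<noteq> j \<Longrightarrow> N' k = N k"
  shows "(\<integral>x. \<phi> x \<partial>site_product N') = (\<Sum>a\<in>set_pmf (N' i). \<Sum>b\<in>set_pmf (N' j).
      pmf (N' i) a * pmf (N' j) b * (\<integral>x. \<phi> (x(i := a, j := b)) \<partial>site_product N))"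
proof -
  have expand: "(\<integral>x. \<phi> x \<partial>site_product N') = (\<Sum>a\<in>set_pmf (N' i). \<Sum>b\<in>set_pmf (N' j).
      pmf (N' i) a * pmf (N' j) b * (\<integral>x. \<phi> (x(j := b, i := a)) \<partial>site_product N'))"
  proof -
    have "(\<integral>x. \<phi> (x(i := a)) \<partial>site_product N') =
        (\<Sum>b\<in>set_pmf (N' j). pmf (N' j) b * (\<integral>x. \<phi> (x(j := b, i := a)) \<partial>site_product N'))" for a
      using bounded_cylinder_update_site[OF \<phi>, where i = i and t = "\<lambda>_. a"] fin(2)
      by (rule integral_finite_support_site)
    then show ?thesis
      by (subst integral_finite_support_site[where N = N' and i = i, OF \<phi> fin(1)])
         (simp add: sum_distrib_left mult.assoc)
  qed
  have "(\<integral>x. \<phi> (x(j := b, i := a)) \<partial>site_product N') = (\<integral>x. \<phi> (x(i := a, j := b)) \<partial>site_product N)" for a b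
  proof -
    have "N'(i := return_pmf a, j := return_pmf b) = N(i := return_pmf a, j := return_pmf b)"
      using N' by auto
    then show ?thesis
      using integral_update_two_sites[OF \<phi> ij, where t = "\<lambda>_. a" and s = "\<lambda>_. b"] ij
      by (simp add: fun_upd_twist)
  qed
  with expand show ?thesis by simp
qed

lemma asep_shock_evolution:
  fixes p q :: real and \<rho> :: "int \<Rightarrow> real"
  assumes pq: "0 \<le> p" "0 \<le> q" and q_pos: "(\<exists>i. m i = 1) \<longrightarrow> 0 < q"
    and \<rho>: "\<And>i. 0 < \<rho> i" "\<And>i. \<rho> i < 1" and m: "\<And>i. m i \<in> {0, 1}"
    and ratio: "\<And>i. \<rho> (i+1) * (1 - \<rho> i) / (\<rho> i * (1 - \<rho> (i+1))) = (if m (i+1) = 0 then 1 else p / q)"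
    and \<mu>: "\<And>r k. 0 < r \<Longrightarrow> r < 1 \<Longrightarrow> k \<in> {0, 1} \<Longrightarrow>
           pmf (\<mu> r k) 0 = 1 - pmf (\<mu> r k) 1 \<and> pmf (\<mu> r k) 0 = (if k = 0 then 1 - r else 1)"
    and dyn: "coupled_dynamics I (asep_p p) (asep_q q) (shock_measure \<mu> \<rho> m) S"
  shows "shock_evolution (asep_p p) (asep_q q) S \<mu> \<rho> m
          (\<lambda>k l r s. real k * (1 - real l) * ((1 - s) * p + s * q))
          (\<lambda>k l r s. (1 - real k) * real l * ((1 - r) * q + r * p))
          (\<lambda>i. \<rho>(i := \<rho> (i-1)))
          (\<lambda>i. \<rho>(i := \<rho> (i+1)))"
proof -
  define L where "L s k = pair_law (\<mu> s k) k" for s k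
  define N where "N = (\<lambda>i. L (\<rho> i) (m i))"
  define T where "T \<phi> i = (if m i = 0 then (p - q) * \<rho> i * (1 - \<rho> i) *
      ((\<integral>x. \<phi> (x(i := (1, 1))) \<partial>site_product N) - (\<integral>x. \<phi> (x(i := (0, 0))) \<partial>site_product N)) else 0)"
    for \<phi> :: "coupled_config \<Rightarrow> real" and i
  let ?P = "\<lambda>k l (r::real) s. real k * (1 - real l) * ((1 - s) * p + s * q)"
  let ?Q = "\<lambda>k l r (s::real). (1 - real k) * real l * ((1 - r) * q + r * p)"
  let ?R = "\<lambda>i. \<rho>(i := \<rho> (i-1))" and ?L = "\<lambda>i. \<rho>(i := \<rho> (i+1))"
  have shock: "shock_measure \<mu> \<sigma>' m' = site_product (\<lambda>i. L (\<sigma>' i) (m' i))" for \<sigma>' m'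
    by (simp add: shock_measure_eq L_def)
  have support: "set_pmf (\<mu> r k) \<subseteq> {0, 1}" if "0 < r" "r < 1" "k \<in> {0, 1}" for r k
  proof -
    have "measure_pmf.prob (\<mu> r k) {0, 1} = 1"
      using \<mu>[OF that] by (simp add: measure_measure_pmf_finite)
    then show ?thesis
      by (subst (asm) measure_pmf.prob_eq_1) (auto simp: AE_measure_pmf_iff)
  qed
  have set_0: "set_pmf (L r 0) = {(0, 0), (1, 1)}"
    and pmf_0: "pmf (L r 0) (0, 0) = 1 - r" "pmf (L r 0) (1, 1) = r" if r: "0 < r" "r < 1" for r
  proof -
    have pmf: "pmf (\<mu> r 0) 0 = 1 - r" "pmf (\<mu> r 0) 1 = r"
      using \<mu>[OF r, of 0] by auto
    then have "set_pmf (\<mu> r 0) = {0, 1}"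
      using support[OF r, of 0] r by (auto simp: set_pmf_iff)
    then show "set_pmf (L r 0) = {(0, 0), (1, 1)}"
      by (auto simp: L_def pair_law_def)
    show "pmf (L r 0) (0, 0) = 1 - r" "pmf (L r 0) (1, 1) = r"
      using pmf pmf_map_inj'[of "\<lambda>y. (y, y + int 0)" "\<mu> r 0"]
      by (simp_all add: L_def pair_law_def inj_def)
  qed
  have L_1: "L r 1 = return_pmf (0, 1)" if r: "0 < r" "r < 1" for r
  proof -
    have "set_pmf (\<mu> r 1) \<subseteq> {0}"
      using support[OF r, of 1] \<mu>[OF r, of 1] by (auto simp: set_pmf_iff)
    then have "\<mu> r 1 = return_pmf 0"
      by (simp add: set_pmf_subset_singleton)
    then show ?thesis
      by (simp add: L_def pair_law_def)
  qed
  have rates: "\<bar>asep_p p y z\<bar> \<le> p + q" "\<bar>asep_q q y z\<bar> \<le> p + q" for y z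
    using pq by (auto simp: asep_p_def asep_q_def)
  show ?thesis
  proof (rule shock_evolution_telescope[OF dyn, where T = T])
    fix \<phi> i assume \<phi>: "bounded_cylinder \<phi>"
    note gen = bounded_cylinder_generator_term[OF \<phi>, of "asep_p p" "p + q" "asep_q q" i, OF rates]
    show "integrable (shock_measure \<mu> \<rho> m) (\<lambda>x. coupled_generator_term (asep_p p) (asep_q q) \<phi> x i)"
      unfolding shock by (rule bounded_cylinder_integrable[OF gen])
    show "T \<phi> i = 0" if "\<And>x a. \<phi> (x(i := a)) = \<phi> x"
      by (simp add: T_def that)
    define \<Phi> where "\<Phi> a b = (\<integral>x. \<phi> (x(i := a, i + 1 := b)) \<partial>site_product N)" for a b
    have ij: "i \<noteq> i + 1" by simp
    have fin: "finite (set_pmf (L r k))" if "0 < r" "r < 1" "k \<in> {0, 1}" for r k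
      using that set_0[of r] L_1[of r] by auto
    have expand: "(\<integral>x. \<psi> x \<partial>site_product M) = (\<Sum>a\<in>set_pmf (M i). \<Sum>b\<in>set_pmf (M (i + 1)).
        pmf (M i) a * pmf (M (i + 1)) b * (\<integral>x. \<psi> (x(i := a, i + 1 := b)) \<partial>site_product N))"
      if "bounded_cylinder \<psi>" "finite (set_pmf (M i))" "finite (set_pmf (M (i + 1)))"
        "\<And>k. k \<noteq> i \<Longrightarrow> k \<noteq> i + 1 \<Longrightarrow> M k = N k" for \<psi> M
      using that ij by (intro integral_finite_support_two_sites)
    \<comment> \<open>With the states of the two sites pinned, the rates are constants and leave the integral.\<close>
    have pinned: "(\<integral>x. coupled_generator_term (asep_p p) (asep_q q) \<phi> (x(i := a, i + 1 := b)) i \<partial>site_product N) =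
        asep_p p (fst a) (snd b) * (\<Phi> (fst a - 1, snd a - 1) (fst b + 1, snd b + 1) - \<Phi> a b)
      + (asep_p p (fst a) (fst b) - asep_p p (fst a) (snd b)) * (\<Phi> (fst a - 1, snd a) (fst b + 1, snd b) - \<Phi> a b)
      + (asep_p p (snd a) (snd b) - asep_p p (fst a) (snd b)) * (\<Phi> (fst a, snd a - 1) (fst b, snd b + 1) - \<Phi> a b)
      + asep_q q (snd a) (fst b) * (\<Phi> (fst a + 1, snd a + 1) (fst b - 1, snd b - 1) - \<Phi> a b)
      + (asep_q q (snd a) (snd b) - asep_q q (snd a) (fst b)) * (\<Phi> (fst a, snd a + 1) (fst b, snd b - 1) - \<Phi> a b)
      + (asep_q q (fst a) (fst b) - asep_q q (snd a) (fst b)) * (\<Phi> (fst a + 1, snd a) (fst b - 1, snd b) - \<Phi> a b)"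
      for a b
    proof -
      have [simp]: "integrable (site_product N) (\<lambda>x. \<phi> (x(i := u, i + 1 := v)))" for u v
        by (intro bounded_cylinder_integrable bounded_cylinder_update_two_sites \<phi> ij)
      have "i + 1 \<noteq> i" by simp
      then show ?thesis
        by (simp add: coupled_generator_term_eq Let_def \<Phi>_def fun_upd_twist)
    qed
    have T_eq: "T \<phi> i = (if m i = 0 then (p - q) * \<rho> i * (1 - \<rho> i) *
        (\<Sum>b\<in>set_pmf (N (i + 1)). pmf (N (i + 1)) b * (\<Phi> (1, 1) b - \<Phi> (0, 0) b)) else 0)"
      "T \<phi> (i + 1) = (if m (i + 1) = 0 then (p - q) * \<rho> (i + 1) * (1 - \<rho> (i + 1)) *
        (\<Sum>a\<in>set_pmf (N i). pmf (N i) a * (\<Phi> a (1, 1) - \<Phi> a (0, 0))) else 0)"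
    proof -
      have "(\<integral>x. \<phi> (x(i := a)) \<partial>site_product N) = (\<Sum>b\<in>set_pmf (N (i + 1)). pmf (N (i + 1)) b * \<Phi> a b)" for a
        using integral_finite_support_site[where N = N and i = "i + 1",
            OF bounded_cylinder_update_site[OF \<phi>, where i = i and t = "\<lambda>_. a"]] fin[OF \<rho> m]
        by (simp add: \<Phi>_def N_def fun_upd_twist)
      moreover have "(\<integral>x. \<phi> (x(i + 1 := b)) \<partial>site_product N) = (\<Sum>a\<in>set_pmf (N i). pmf (N i) a * \<Phi> a b)" for b
        using integral_finite_support_site[where N = N and i = i,
            OF bounded_cylinder_update_site[OF \<phi>, where i = "i + 1" and t = "\<lambda>_. b"]] fin[OF \<rho> m]
        by (simp add: \<Phi>_def N_def)
      ultimately show "T \<phi> i = (if m i = 0 then (p - q) * \<rho> i * (1 - \<rho> i) *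
          (\<Sum>b\<in>set_pmf (N (i + 1)). pmf (N (i + 1)) b * (\<Phi> (1, 1) b - \<Phi> (0, 0) b)) else 0)"
        "T \<phi> (i + 1) = (if m (i + 1) = 0 then (p - q) * \<rho> (i + 1) * (1 - \<rho> (i + 1)) *
          (\<Sum>a\<in>set_pmf (N i). pmf (N i) a * (\<Phi> a (1, 1) - \<Phi> a (0, 0))) else 0)"
        by (simp_all add: T_def sum_subtractf right_diff_distrib)
    qed
    have m_i: "m i = 0 \<or> m i = 1" and m_j: "m (i + 1) = 0 \<or> m (i + 1) = 1"
      using m by auto
    let ?r = "\<rho> i" and ?s = "\<rho> (i + 1)"
    have N_expand: "(\<integral>x. \<psi> x \<partial>site_product N) = (\<Sum>a\<in>set_pmf (N i). \<Sum>b\<in>set_pmf (N (i + 1)).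
        pmf (N i) a * pmf (N (i + 1)) b * (\<integral>x. \<psi> (x(i := a, i + 1 := b)) \<partial>site_product N))"
      if "bounded_cylinder \<psi>" for \<psi>
      by (rule expand) (use that fin[OF \<rho> m] in \<open>auto simp: N_def\<close>)
    note \<rho>_i = \<rho>[of i] and \<rho>_j = \<rho>[of "i + 1"]
    have N_i: "N i = L ?r (m i)" and N_j: "N (i + 1) = L ?s (m (i + 1))"
      by (simp_all add: N_def)
    note eval = N_i N_j set_0[OF \<rho>_i] set_0[OF \<rho>_j] pmf_0[OF \<rho>_i] pmf_0[OF \<rho>_j]
      L_1[OF \<rho>_i] L_1[OF \<rho>_j] L_1[OF \<rho>_i, unfolded One_nat_def] L_1[OF \<rho>_j, unfolded One_nat_def]
    have shock_term: "shock_term \<mu> \<rho> m ?P ?Q ?R ?L \<phi> i =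
        ?P (m i) (m (i + 1)) ?r ?s * ((\<integral>x. \<phi> x \<partial>site_product (\<lambda>k. L (?R i k) (move i (i + 1) m k))) - (\<integral>x. \<phi> x \<partial>site_product N))
      + ?Q (m i) (m (i + 1)) ?r ?s * ((\<integral>x. \<phi> x \<partial>site_product (\<lambda>k. L (?L i k) (move (i + 1) i m k))) - (\<integral>x. \<phi> x \<partial>site_product N))"
      by (simp add: shock_term_def shock N_def)
    have "(\<integral>x. coupled_generator_term (asep_p p) (asep_q q) \<phi> x i \<partial>site_product N) =
        shock_term \<mu> \<rho> m ?P ?Q ?R ?L \<phi> i + (T \<phi> (i + 1) - T \<phi> i)"
      using m_i m_j
    proof (elim disjE)
      assume m0: "m i = 0" "m (i + 1) = 0"
      then have "?s = ?r"
        using ratio[of i] \<rho>_i \<rho>_j by (simp add: divide_simps algebra_simps)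
      then show ?thesis
        unfolding shock_term T_eq N_expand[OF gen] N_expand[OF \<phi>] pinned \<Phi>_def[symmetric]
        by (simp add: m0 eval asep_p_def asep_q_def, simp add: algebra_simps)
    next
      assume m10: "m i = 1" "m (i + 1) = 0"
      \<comment> \<open>The second class particle exchanges with a hole or with a particle at site \<open>i + 1\<close>, at rates
        \<open>p\<close> and \<open>q\<close>.  The density at \<open>i\<close> after the jump is the conditional one, given that it happens:
        \<open>\<rho>\<^sub>i\<^sub>-\<^sub>1 = q \<rho>\<^sub>i / rate\<close>.\<close>
      let ?r' = "\<rho> (i - 1)" and ?M = "\<lambda>k. L (?R i k) (move i (i + 1) m k)"
      let ?rate = "(1 - ?s) * p + ?s * q"
      have q: "0 < q" using q_pos m10(1) by blast
      have s: "?s = ?r"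
        using ratio[of i] \<rho>_i \<rho>_j m10 by (simp add: divide_simps algebra_simps)
      have "?r * (1 - ?r') * q = p * (?r' * (1 - ?r))"
        using ratio[of "i - 1"] \<rho>_i \<rho>[of "i - 1"] m10 q by (simp add: divide_simps algebra_simps)
      then have rate: "?rate * ?r' = q * ?r" "?rate * (1 - ?r') = p * (1 - ?r)"
        unfolding s by (simp_all add: algebra_simps)
      have M: "?M i = L ?r' 0" "?M (i + 1) = L ?s 1"
        using m10 by (simp_all add: move_def)
      have "(\<integral>x. \<phi> x \<partial>site_product ?M) = (1 - ?r') * \<Phi> (0, 0) (0, 1) + ?r' * \<Phi> (1, 1) (0, 1)"
      proof -
        have fin_M: "finite (set_pmf (?M i))" "finite (set_pmf (?M (i + 1)))"
          unfolding M by (simp_all add: fin \<rho>)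
        have off: "?M k = N k" if "k \<noteq> i" "k \<noteq> i + 1" for k
          using that by (simp add: N_def move_def)
        show ?thesis
          by (rule trans[OF expand[OF \<phi> fin_M]], erule (1) off, unfold M)
             (simp add: set_0 pmf_0 L_1[unfolded One_nat_def] \<rho> \<Phi>_def)
      qed
      then have "?rate * (\<integral>x. \<phi> x \<partial>site_product ?M) = p * (1 - ?r) * \<Phi> (0, 0) (0, 1) + q * ?r * \<Phi> (1, 1) (0, 1)"
        by (simp only: distrib_left mult.assoc[symmetric] rate)
      moreover have "shock_term \<mu> \<rho> m ?P ?Q ?R ?L \<phi> i =
          ?rate * (\<integral>x. \<phi> x \<partial>site_product ?M) - ?rate * (\<integral>x. \<phi> x \<partial>site_product N)"
        unfolding shock_term m10 by (simp only: right_diff_distrib) simp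
      ultimately show ?thesis
        unfolding T_eq N_expand[OF gen] N_expand[OF \<phi>] pinned \<Phi>_def[symmetric]
        by (simp add: m10 s eval asep_p_def asep_q_def, simp add: algebra_simps)
    next
      assume m01: "m i = 0" "m (i + 1) = 1"
      \<comment> \<open>The mirror image: a particle or a hole at site \<open>i\<close> exchanges with the second class particle, and
        the law at site \<open>i + 1\<close> after the jump has \<open>\<rho>\<^sub>i\<^sub>+\<^sub>1 = p \<rho>\<^sub>i / rate\<close>.\<close>
      let ?M = "\<lambda>k. L (?L i k) (move (i + 1) i m k)"
      let ?rate = "(1 - ?r) * q + ?r * p"
      have q: "0 < q" using q_pos m01(2) by blast
      have "?s * (1 - ?r) * q = p * (?r * (1 - ?s))"
        using ratio[of i] \<rho>_i \<rho>_j m01 q by (simp add: divide_simps algebra_simps)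
      then have rate: "?rate * ?s = p * ?r" "?rate * (1 - ?s) = q * (1 - ?r)"
        by (simp_all add: algebra_simps)
      have M: "?M i = L ?s 1" "?M (i + 1) = L ?s 0"
        using m01 by (simp_all add: move_def)
      have "(\<integral>x. \<phi> x \<partial>site_product ?M) = (1 - ?s) * \<Phi> (0, 1) (0, 0) + ?s * \<Phi> (0, 1) (1, 1)"
      proof -
        have fin_M: "finite (set_pmf (?M i))" "finite (set_pmf (?M (i + 1)))"
          unfolding M by (simp_all add: fin \<rho>)
        have off: "?M k = N k" if "k \<noteq> i" "k \<noteq> i + 1" for k
          using that by (simp add: N_def move_def)
        show ?thesis
          by (rule trans[OF expand[OF \<phi> fin_M]], erule (1) off, unfold M)
             (simp add: set_0 pmf_0 L_1[unfolded One_nat_def] \<rho> \<Phi>_def)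
      qed
      then have "?rate * (\<integral>x. \<phi> x \<partial>site_product ?M) = q * (1 - ?r) * \<Phi> (0, 1) (0, 0) + p * ?r * \<Phi> (0, 1) (1, 1)"
        by (simp only: distrib_left mult.assoc[symmetric] rate)
      moreover have "shock_term \<mu> \<rho> m ?P ?Q ?R ?L \<phi> i =
          ?rate * (\<integral>x. \<phi> x \<partial>site_product ?M) - ?rate * (\<integral>x. \<phi> x \<partial>site_product N)"
        unfolding shock_term m01 by (simp only: right_diff_distrib) simp
      ultimately show ?thesis
        unfolding T_eq N_expand[OF gen] N_expand[OF \<phi>] pinned \<Phi>_def[symmetric]
        by (simp add: m01 eval asep_p_def asep_q_def, simp add: algebra_simps)
    next
      assume m1: "m i = 1" "m (i + 1) = 1"
      then show ?thesis
        unfolding shock_term T_eq N_expand[OF gen] N_expand[OF \<phi>] pinned \<Phi>_def[symmetric]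
        by (simp add: eval asep_p_def asep_q_def)
    qed
    then show "(\<integral>x. coupled_generator_term (asep_p p) (asep_q q) \<phi> x i \<partial>shock_measure \<mu> \<rho> m) =
        shock_term \<mu> \<rho> m ?P ?Q ?R ?L \<phi> i + (T \<phi> (i + 1) - T \<phi> i)"
      by (simp add: shock N_def)
  qed
qed

section \<open>The evolution of shock measures\<close>

theorem theorem3p3:
  fixes m :: "int \<Rightarrow> nat"
    and \<mu> :: "real \<Rightarrow> nat \<Rightarrow> int pmf"
    and S :: "real \<Rightarrow> coupled_config \<Rightarrow> coupled_config measure"
  assumes "(\<lambda>i. real (m i)) summable_on UNIV"
  shows
    "(\<forall>p q \<rho>.
        q < p \<and> 0 \<le> q \<and> p + q = 1 \<and> ((\<exists>i. m i = 1) \<longrightarrow> 0 < q) \<and>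
        (\<forall>i. 0 < \<rho> i \<and> \<rho> i < 1) \<and> (\<forall>i. m i \<in> {0, 1}) \<and>
        (\<forall>i. \<rho> (i+1) * (1 - \<rho> i) / (\<rho> i * (1 - \<rho> (i+1))) = (if m (i+1) = 0 then 1 else p / q)) \<and>
        (\<forall>r k. 0 < r \<and> r < 1 \<and> k \<in> {0, 1} \<longrightarrow>
           pmf (\<mu> r k) 0 = 1 - pmf (\<mu> r k) 1 \<and> pmf (\<mu> r k) 0 = (if k = 0 then 1 - r else 1)) \<and>
        coupled_dynamics {0, 1} (asep_p p) (asep_q q) (shock_measure \<mu> \<rho> m) S
        \<longrightarrow>
        shock_evolution (asep_p p) (asep_q q) S \<mu> \<rho> m
          (\<lambda>k l r s. real k * (1 - real l) * ((1 - s) * p + s * q))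
          (\<lambda>k l r s. (1 - real k) * real l * ((1 - r) * q + r * p))
          (\<lambda>i. \<rho>(i := \<rho> (i-1)))
          (\<lambda>i. \<rho>(i := \<rho> (i+1))))
     \<and>
     (\<forall>\<beta> \<sigma>.
        0 < \<beta> \<and> (\<forall>i. \<sigma> (i-1) - \<sigma> i = \<beta> * real (m i)) \<and>
        (\<forall>s k y. pmf (\<mu> s k) y = stationary_weight \<beta> s y)
        \<longrightarrow>
        (coupled_dynamics UNIV (gzrp_p \<beta>) zero_rate (shock_measure \<mu> \<sigma> m) S \<longrightarrow>
         shock_evolution (gzrp_p \<beta>) zero_rate S \<mu> \<sigma> m
           (\<lambda>k l r s. exp (r + \<beta> * real k) - exp r)
           (\<lambda>k l r s. 0)
           (\<lambda>i. \<sigma>(i := \<sigma> i + \<beta>))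
           (\<lambda>i. \<sigma>(i := \<sigma> i - \<beta>)))
        \<and>
        (coupled_dynamics UNIV (blp_p \<beta>) zero_rate (shock_measure \<mu> \<sigma> m) S \<longrightarrow>
         shock_evolution (blp_p \<beta>) zero_rate S \<mu> \<sigma> m
           (\<lambda>k l r s. exp (r + \<beta> * real k) - exp r)
           (\<lambda>k l r s. exp (- s) - exp (- s - \<beta> * real l))
           (\<lambda>i. \<sigma>(i := \<sigma> i + \<beta>))
           (\<lambda>i. \<sigma>(i := \<sigma> i - \<beta>))))"
proof (intro conjI allI impI, goal_cases)
  case (1 p q \<rho>)
  show ?case
  proof (rule asep_shock_evolution)
    show "0 \<le> p" using 1 by linarith
  qed (use 1 in blast)+
next
  case (2 \<beta> \<sigma>)
  then show ?case
    using exponential_shock_evolution[where p = "gzrp_p \<beta>" and \<kappa> = 0 and \<beta> = \<beta> and \<sigma> = \<sigma> and m = m and \<mu> = \<mu>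
        and S = S and I = UNIV]
    by (simp add: gzrp_p_def)
next
  case (3 \<beta> \<sigma>)
  then show ?case
    using exponential_shock_evolution[where p = "blp_p \<beta>" and \<kappa> = 1 and \<beta> = \<beta> and \<sigma> = \<sigma> and m = m and \<mu> = \<mu>
        and S = S and I = UNIV]
    by (simp add: blp_p_def)
qed

end
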